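(* Let $\mathbb{K}$ be a field, $R=\mathbb{K}[x_1,\dots,x_n]$, $\mathbf{a}\in\mathbb{N}^n$, and let $I$ be an $\mathbf{a}$-determined strongly stable ideal in $R$ generated in degree $d$. Then the cellular complex $\mathcal{F}_{X_I}$ provides a minimal free resolution of $R/\widehat{I}^{[\mathbf{a}]}$, where $\widehat{I}^{[\mathbf{a}]}$ is the $\mathbf{a}$-dual of $I$.
   Context: For a monomial ideal $I$, $G(I)$ is its minimal set of monomial generators; $I$ generated in degree $d$ means all elements of $G(I)$ have degree $d$. For $\mathbf{a}\in\mathbb{N}^n$ put $\mathbf{x}^{\mathbf{a}}=\prod_k x_k^{\mathbf{a}(k)}$. $I$ is $\mathbf{a}$-determined if every $f\in G(I)$ divides $\mathbf{x}^{\mathbf{a}}$; then $\widehat{f}:=\mathbf{x}^{\mathbf{a}}/f$ and the $\mathbf{a}$-dual $\widehat{I}^{[\mathbf{a}]}$ is the monomial ideal with $G(\widehat{I}^{[\mathbf{a}]})=\{\widehat{f}\mid f\in G(I)\}$. $I$ is strongly stable if for each monomial $m\in I$, each $x_i$ dividing $m$ and each $j<i$, $mx_j/x_i\in I$. The complex $X_I$. Monomials are identified with exponent vectors in $\mathbb{N}^n\subset\mathbb{R}^n$. For a monomial $m$, $\operatorname{supp}_1(m)=\{i\ge 2\mid x_i\text{ divides }m\}$. For $m\in G(I)$ and $\sigma\subseteq\operatorname{supp}_1(m)$, let $m\to\sigma$ be the monomial $m\prod_{i\in\sigma}(x_{i-1}/x_i)$ (which again lies in $G(I)$), and let $C(m,\sigma)$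 be the convex hull of $\{m\to\tau\mid\tau\subseteq\sigma\}$ in $\mathbb{R}^n$. Then $X_I=\{C(m,\sigma)\mid m\in G(I),\ \sigma\subseteq\operatorname{supp}_1(m)\}$, together with the empty face (the unique face of dimension $-1$). It is a polyhedral cell complex, $C(m,\sigma)$ is a cell of dimension $|\sigma|$, and $m,\sigma$ are determined by $C(m,\sigma)$. Labels: the vertex corresponding to $f\in G(I)$ is labeled by $\widehat{f}$, and each cell is labeled by the lcm of the labels of its vertices (the empty face by $1$); thus $C(f,\sigma)$ has label $\widehat{f}\prod_{j\in\sigma}x_j$. Incidence function $\varepsilon$: let $F_1=C(f,\sigma)$ with $\sigma=\{i_1<\dots<i_k\}$, $k\ge1$, and let $F_2$ be a $(k-1)$-dimensional face of $F_1$. If $F_2=C(f,\sigma\setminus\{i_j\})$, put $\varepsilon(F_2,F_1)=(-1)^{j-1}$. Otherwise there is a unique face $F_3$ of $F_1$ of the same dimension parallel to $F_2$, and $\varepsilon(F_2,F_1)=-\varepsilon(F_3,F_1)$. For a vertex $P$, $\varepsilon(\varnothing,P)=1$. The complex $\mathcal{F}_{X_I}$: let $F_k(X_I)$ be the set of $k$-dimensional faces and, for a face $P$ with label $\mathbf{x}^{\boldsymbol\alpha_P}$, let $R(-\boldsymbol\alpha_P)$ be the free $\mathbb{N}^n$-graded module with one generator, also denoted $P$, in multidegree $\boldsymbol\alpha_P$. Then $\mathcal{F}_{X_I}$ is $$0\to R^{F_D(X_I)}\xrightarrow{\partial_D}\cdots\xrightarrow{\partial_1}R^{F_0(X_I)}\xrightarrow{\partial_0}R^{F_{-1}(X_I)}=R\to0,$$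 with $D=\dim X_I$, $R^{F_k(X_I)}=\bigoplus_{P\in F_k(X_I)}R(-\boldsymbol\alpha_P)$, and $\partial(P)=\sum_{Q}\varepsilon(Q,P)\,\mathbf{x}^{\boldsymbol\alpha_P-\boldsymbol\alpha_Q}Q$, the sum over the faces $Q$ of $P$ with $\dim Q=\dim P-1$. The statement means that $\mathcal{F}_{X_I}$ (with the rightmost $R$ in homological degree $0$) is a minimal $\mathbb{N}^n$-graded free resolution of $R/\widehat{I}^{[\mathbf{a}]}$.
   Formalization: Minimality is claimed only when the a-dual of I is a proper ideal; for I=(x_1^d), a=(d,0,...,0) the dual is R and the complex 0→R→R→0 with the identity map resolves 0 but is not minimal. The free resolution itself is proved in all cases. *)

theory Defs
  imports "HOL-Analysis.Analysis" "HOL-Library.Poly_Mapping"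
begin

section \<open>Polynomials and monomial ideals\<close>

text \<open>
  The variables are indexed by a nonempty finite linearly ordered type \<open>'n\<close>, which plays the role of
  \<open>{1 < \<dots> < n}\<close>. A monomial is given by its exponent vector in \<open>nat^'n\<close>; divisibility of
  monomials is the componentwise order \<open>\<le>\<close> of the library, and multiplication is addition.
  The polynomial ring is the monoid algebra of \<open>nat^'n\<close> over \<open>'k\<close>.
\<close>

type_synonym 'n exponent = "nat^'n"
type_synonym ('n, 'k) mpolynomial = "'n exponent \<Rightarrow>\<^sub>0 'k"
type_synonym 'n polyhedron = "(real^'n) set"

definition xpow :: "'n exponent \<Rightarrow> ('n::finite, 'k::field) mpolynomial"
  where "xpow m = Poly_Mapping.single m 1"

definition var_exp :: "'n \<Rightarrow> 'n::finite exponent"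
  where "var_exp i = axis i 1"

definition mono_degree :: "'n::finite exponent \<Rightarrow> nat"
  where "mono_degree m = (\<Sum>i\<in>UNIV. m $ i)"

text \<open>The empty lcm is the monomial 1, i.e. the exponent 0.\<close>

definition mono_lcm :: "'n::finite exponent set \<Rightarrow> 'n exponent"
  where "mono_lcm S = (\<chi> i. Max (insert 0 ((\<lambda>m. m $ i) ` S)))"

text \<open>
  The ideal generated by \<open>S\<close> is the span of \<open>S\<close> in the ring as a module over itself. This module is not
  interpreted globally, since the simp rules of the locale would loop with \<open>mult.assoc\<close>.
\<close>

lemma module_times: "module ((*) :: 'r::comm_ring_1 \<Rightarrow> 'r \<Rightarrow> 'r)"
  by (rule module.intro) (simp_all add: algebra_simps)

definition mono_ideal :: "'n exponent set \<Rightarrow> ('n::finite, 'k::field) mpolynomial set"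
  where "mono_ideal S = module.span (*) (xpow ` S)"

definition monomial_ideal :: "('n::finite, 'k::field) mpolynomial set \<Rightarrow> bool"
  where "monomial_ideal I \<longleftrightarrow> (\<exists>S. I = mono_ideal S)"

definition min_gens :: "('n::finite, 'k::field) mpolynomial set \<Rightarrow> 'n exponent set"
  where "min_gens I = (THE S. I = mono_ideal S \<and> (\<forall>T. T \<subset> S \<longrightarrow> mono_ideal T \<noteq> I))"

definition generated_in_degree :: "nat \<Rightarrow> ('n::finite, 'k::field) mpolynomial set \<Rightarrow> bool"
  where "generated_in_degree d I \<longleftrightarrow> (\<forall>f\<in>min_gens I. mono_degree f = d)"

definition determined :: "'n exponent \<Rightarrow> ('n::finite, 'k::field) mpolynomial set \<Rightarrow> bool"
  where "determined a I \<longleftrightarrow> (\<forall>f\<in>min_gens I. f \<le> a)"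

definition dual_ideal ::
    "'n exponent \<Rightarrow> ('n::finite, 'k::field) mpolynomial set \<Rightarrow> ('n, 'k) mpolynomial set"
  where "dual_ideal a I = mono_ideal ((\<lambda>f. a - f) ` min_gens I)"

definition strongly_stable :: "('n::{finite,linorder}, 'k::field) mpolynomial set \<Rightarrow> bool"
  where "strongly_stable I \<longleftrightarrow> monomial_ideal I \<and>
    (\<forall>m i j. xpow m \<in> I \<longrightarrow> 0 < m $ i \<longrightarrow> j < i \<longrightarrow> xpow (m - var_exp i + var_exp j) \<in> I)"

subsection \<open>Minimal generators are well defined\<close>

lemma xpow_mult: "xpow (a + b) = (xpow a * xpow b :: ('n::finite, 'k::field) mpolynomial)"
  by (simp add: xpow_def mult_single)

lemma xpow_mem_mono_ideal_iff:
  "(xpow m :: ('n::finite, 'k::field) mpolynomial) \<in> mono_ideal S \<longleftrightarrow> (\<exists>s\<in>S. s \<le> m)"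
proof
  define A :: "('n, 'k) mpolynomial set" where "A = {p. \<forall>k\<in>Poly_Mapping.keys p. \<exists>s\<in>S. s \<le> k}"
  have "module.subspace (*) A"
  proof (rule module.subspaceI[OF module_times])
    show "0 \<in> A" by (simp add: A_def)
    show "p + q \<in> A" if "p \<in> A" "q \<in> A" for p q
      using that Poly_Mapping.keys_add[of p q] by (auto simp: A_def)
    show "c * p \<in> A" if "p \<in> A" for c p
    proof -
      have "\<exists>s\<in>S. s \<le> k" if k: "k \<in> Poly_Mapping.keys (c * p)" for k
      proof -
        obtain u v where "k = u + v" "v \<in> Poly_Mapping.keys p"
          using k subsetD[OF Poly_Mapping.keys_mult k] by blast
        moreover from this \<open>p \<in> A\<close> obtain s where "s \<in> S" "s \<le> v" by (auto simp: A_def)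
        ultimately show ?thesis by (auto simp: less_eq_vec_def intro!: bexI[of _ s] trans_le_add2)
      qed
      then show ?thesis by (simp add: A_def)
    qed
  qed
  moreover have "xpow ` S \<subseteq> A" by (auto simp: A_def xpow_def)
  ultimately have "mono_ideal S \<subseteq> A" unfolding mono_ideal_def by (rule module.span_minimal[OF module_times, rotated])
  moreover assume "(xpow m :: ('n, 'k) mpolynomial) \<in> mono_ideal S"
  ultimately show "\<exists>s\<in>S. s \<le> m" by (auto simp: A_def xpow_def)
next
  assume "\<exists>s\<in>S. s \<le> m"
  then obtain s where s: "s \<in> S" "s \<le> m" by blast
  then have "m = (m - s) + s" by (auto simp: vec_eq_iff less_eq_vec_def)
  then have "xpow m = (xpow (m - s) * xpow s :: ('n, 'k) mpolynomial)" by (metis xpow_mult)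
  then show "(xpow m :: ('n, 'k) mpolynomial) \<in> mono_ideal S"
    using s(1) by (simp add: mono_ideal_def module.span_scale[OF module_times] module.span_base[OF module_times])
qed

lemma mono_ideal_subset_iff:
  "(mono_ideal S :: ('n::finite, 'k::field) mpolynomial set) \<subseteq> mono_ideal T \<longleftrightarrow>
    (\<forall>s\<in>S. \<exists>t\<in>T. t \<le> s)"
proof
  assume sub: "(mono_ideal S :: ('n, 'k) mpolynomial set) \<subseteq> mono_ideal T"
  show "\<forall>s\<in>S. \<exists>t\<in>T. t \<le> s"
  proof
    fix s assume "s \<in> S"
    then have "(xpow s :: ('n, 'k) mpolynomial) \<in> mono_ideal S"
      using xpow_mem_mono_ideal_iff by blast
    then show "\<exists>t\<in>T. t \<le> s" using sub xpow_mem_mono_ideal_iff by blast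
  qed
next
  assume "\<forall>s\<in>S. \<exists>t\<in>T. t \<le> s"
  then have "xpow ` S \<subseteq> (mono_ideal T :: ('n, 'k) mpolynomial set)"
    using xpow_mem_mono_ideal_iff by blast
  then show "(mono_ideal S :: ('n, 'k) mpolynomial set) \<subseteq> mono_ideal T"
    unfolding mono_ideal_def by (metis module.span_minimal[OF module_times] module.subspace_span[OF module_times])
qed

lemma minimal_below:
  fixes s :: "'n::finite exponent"
  assumes "s \<in> S"
  shows "\<exists>t\<in>S. t \<le> s \<and> (\<forall>u\<in>S. u \<le> t \<longrightarrow> u = t)"
  using assms
proof (induction "mono_degree s" arbitrary: s rule: less_induct)
  case less
  show ?case
  proof (cases "\<forall>u\<in>S. u \<le> s \<longrightarrow> u = s")
    case True
    then show ?thesis using less.prems by auto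
  next
    case False
    then obtain u where u: "u \<in> S" "u \<le> s" "u \<noteq> s" by blast
    then obtain i where "u $ i < s $ i" by (metis less_eq_vec_def nat_less_le vec_eq_iff)
    then have "mono_degree u < mono_degree s"
      unfolding mono_degree_def using u(2)
      by (intro sum_strict_mono_ex1) (auto simp: less_eq_vec_def)
    from less.hyps[OF this u(1)] u(2) show ?thesis by (meson order_trans)
  qed
qed

lemma min_gens_mono_ideal:
  "min_gens (mono_ideal S :: ('n::finite, 'k::field) mpolynomial set)
    = {s\<in>S. \<forall>u\<in>S. u \<le> s \<longrightarrow> u = s}" (is "_ = ?M")
  unfolding min_gens_def
proof (rule the_equality)
  let ?I = "mono_ideal S :: ('n, 'k) mpolynomial set"
  have below: "\<exists>t\<in>?M. t \<le> s" if "s \<in> S" for s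
    using minimal_below[OF that] by blast
  have M: "?I = mono_ideal ?M"
  proof (rule equalityI)
    show "?I \<subseteq> mono_ideal ?M" by (rule mono_ideal_subset_iff[THEN iffD2]) (use below in blast)
    show "mono_ideal ?M \<subseteq> ?I" by (rule mono_ideal_subset_iff[THEN iffD2]) blast
  qed
  have sub: "\<forall>s\<in>A. \<exists>t\<in>B. t \<le> s"
    if "(mono_ideal A :: ('n, 'k) mpolynomial set) = mono_ideal B" for A B
  proof -
    have "(mono_ideal A :: ('n, 'k) mpolynomial set) \<subseteq> mono_ideal B" using that by simp
    then show ?thesis by (rule mono_ideal_subset_iff[THEN iffD1])
  qed
  have sup: "?M \<subseteq> G" if G: "mono_ideal G = ?I" for G
  proof
    fix t assume t: "t \<in> ?M"
    obtain g where g: "g \<in> G" "g \<le> t" using sub[OF G[symmetric]] t by blast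
    obtain u where u: "u \<in> S" "u \<le> g" using sub[OF G] g by blast
    have "u \<le> t" using u(2) g(2) by (rule order_trans)
    then have "u = t" using t u(1) by blast
    then have "g = t" using u(2) g(2) by simp
    then show "t \<in> G" using g(1) by simp
  qed
  show "?I = mono_ideal ?M \<and> (\<forall>T. T \<subset> ?M \<longrightarrow> mono_ideal T \<noteq> ?I)"
  proof (intro conjI allI impI notI)
    show "?I = mono_ideal ?M" by (rule M)
    fix T assume "T \<subset> ?M" "mono_ideal T = ?I"
    then show False using sup[of T] by blast
  qed
  fix G assume G: "?I = mono_ideal G \<and> (\<forall>T. T \<subset> G \<longrightarrow> mono_ideal T \<noteq> ?I)"
  then have "?M \<subseteq> G" using sup by simp
  moreover have "\<not> ?M \<subset> G" using G M by blast
  ultimately show "G = ?M" by auto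
qed

lemma min_gens_dual_ideal:
  fixes I :: "('n::finite, 'k::field) mpolynomial set"
  assumes "monomial_ideal I" and "determined a I"
  shows "min_gens (dual_ideal a I) = (\<lambda>f. a - f) ` min_gens I"
proof -
  obtain S where I: "I = mono_ideal S" using assms(1) by (auto simp: monomial_ideal_def)
  have anti: "f = g" if "f \<in> min_gens I" "g \<in> min_gens I" "f \<le> g" for f g
    using that unfolding I min_gens_mono_ideal by auto
  have "f = g" if "f \<in> min_gens I" "g \<in> min_gens I" "a - f \<le> a - g" for f g
  proof -
    have "f \<le> a" "g \<le> a" using that assms(2) by (auto simp: determined_def)
    then have "g \<le> f"
      using that(3) by (simp add: less_eq_vec_def) (meson diff_le_mono2 le_diff_iff')
    then show ?thesis using anti that by blast
  qed
  then show ?thesis unfolding dual_ideal_def min_gens_mono_ideal by auto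
qed

section \<open>The cell complex\<close>

text \<open>\<open>pred_index i\<close> stands for \<open>i - 1\<close>; it is only used when \<open>i\<close> is not the first index.\<close>

definition pred_index :: "'n::{finite,linorder} \<Rightarrow> 'n"
  where "pred_index i = Max {j. j < i}"

definition supp1 :: "'n::{finite,linorder} exponent \<Rightarrow> 'n set"
  where "supp1 m = {i. (\<exists>j. j < i) \<and> 0 < m $ i}"

text \<open>
  The monomial \<open>m \<rightarrow> \<sigma>\<close>. For \<open>\<sigma> \<subseteq> supp1 m\<close> the truncated subtraction is an exact one.
\<close>

definition move :: "'n::{finite,linorder} exponent \<Rightarrow> 'n set \<Rightarrow> 'n exponent"
  where "move m \<sigma> = m + (\<Sum>i\<in>\<sigma>. var_exp (pred_index i)) - (\<Sum>i\<in>\<sigma>. var_exp i)"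

definition point :: "'n::finite exponent \<Rightarrow> (real, 'n) vec"
  where "point m = (\<chi> i. real (m $ i))"

definition cell :: "'n::{finite,linorder} exponent \<Rightarrow> 'n set \<Rightarrow> 'n polyhedron"
  where "cell m \<sigma> = convex hull ((\<lambda>\<tau>. point (move m \<tau>)) ` Pow \<sigma>)"

definition cell_complex ::
    "('n::{finite,linorder}, 'k::field) mpolynomial set \<Rightarrow> 'n polyhedron set"
  where "cell_complex I = insert {} {cell m \<sigma> |m \<sigma>. m \<in> min_gens I \<and> \<sigma> \<subseteq> supp1 m}"

text \<open>
  Faces by homological degree: \<open>faces I k\<close> consists of the cells of dimension \<open>k - 1\<close>, so that
  \<open>faces I 0\<close> is \<open>F\<^sub>-\<^sub>1 = {{}}\<close> (the library sets \<open>aff_dim {} = - 1\<close>).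
\<close>

definition faces ::
    "('n::{finite,linorder}, 'k::field) mpolynomial set \<Rightarrow> nat \<Rightarrow> 'n polyhedron set"
  where "faces I k = {P \<in> cell_complex I. aff_dim P = int k - 1}"

definition facets_of :: "'n polyhedron \<Rightarrow> 'n::finite polyhedron set"
  where "facets_of P = {Q. Q face_of P \<and> aff_dim Q = aff_dim P - 1}"

definition label :: "'n exponent \<Rightarrow> 'n::finite polyhedron \<Rightarrow> 'n exponent"
  where "label a P = mono_lcm {a - f |f. point f extreme_point_of P}"

subsection \<open>The incidence function\<close>

text \<open>
  \<open>near_incidence Q P e\<close>: \<open>P = C(f,\<sigma>)\<close> and \<open>Q = C(f,\<sigma> - {i})\<close>; if \<open>i\<close> is the \<open>j\<close>-th smallest
  element of \<open>\<sigma>\<close>, then \<open>j - 1\<close> elements of \<open>\<sigma>\<close> are smaller than \<open>i\<close>.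
\<close>

definition near_incidence :: "'n::{finite,linorder} polyhedron \<Rightarrow> 'n polyhedron \<Rightarrow> int \<Rightarrow> bool"
  where "near_incidence Q P e \<longleftrightarrow> (\<exists>f \<sigma> i. \<sigma> \<subseteq> supp1 f \<and> i \<in> \<sigma> \<and>
    P = cell f \<sigma> \<and> Q = cell f (\<sigma> - {i}) \<and> e = (-1) ^ card {j\<in>\<sigma>. j < i})"

definition parallel_face :: "'n::finite polyhedron \<Rightarrow> 'n polyhedron \<Rightarrow> 'n polyhedron"
  where "parallel_face Q P = (THE F. F face_of P \<and> F \<noteq> Q \<and> aff_dim F = aff_dim Q \<and>
    affine_parallel (affine hull F) (affine hull Q))"

text \<open>Only meaningful for a cell \<open>P\<close> of the complex and \<open>Q \<in> facets_of P\<close>.\<close>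

definition incidence :: "'n::{finite,linorder} polyhedron \<Rightarrow> 'n polyhedron \<Rightarrow> int"
  where "incidence Q P =
    (if Q = {} then 1
     else if \<exists>e. near_incidence Q P e then (THE e. near_incidence Q P e)
     else - (THE e. near_incidence (parallel_face Q P) P e))"

section \<open>Multigraded free resolutions\<close>

text \<open>
  The free module on a set \<open>B\<close> of basis elements consists of the finitely supported functions
  on \<open>B\<close>; the basis element \<open>b\<close> is \<open>Poly_Mapping.single b 1\<close>.
\<close>

definition free_module :: "'b set \<Rightarrow> ('b \<Rightarrow>\<^sub>0 'r::zero) set"
  where "free_module B = {u. Poly_Mapping.keys u \<subseteq> B}"

definition scale :: "'r::comm_ring_1 \<Rightarrow> ('b \<Rightarrow>\<^sub>0 'r) \<Rightarrow> ('b \<Rightarrow>\<^sub>0 'r)"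
  where "scale r u = Poly_Mapping.map ((*) r) u"

lemma module_scale: "module (scale :: 'r::comm_ring_1 \<Rightarrow> ('b \<Rightarrow>\<^sub>0 'r) \<Rightarrow> ('b \<Rightarrow>\<^sub>0 'r))"
proof -
  have lookup: "Poly_Mapping.lookup (scale r u) b = r * Poly_Mapping.lookup u b"
    for r :: 'r and u :: "'b \<Rightarrow>\<^sub>0 'r" and b
    by (simp add: scale_def Poly_Mapping.map.rep_eq when_def)
  show ?thesis
    by (rule module.intro; rule poly_mapping_eqI, simp add: lookup lookup_add algebra_simps)
qed

text \<open>Basis element \<open>b\<close> has multidegree \<open>\<alpha> b\<close>.\<close>

definition homogeneous ::
    "('b \<Rightarrow> 'n exponent) \<Rightarrow> 'n exponent \<Rightarrow> ('b \<Rightarrow>\<^sub>0 ('n::finite, 'k::field) mpolynomial) \<Rightarrow> bool"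
  where "homogeneous \<alpha> \<gamma> u \<longleftrightarrow>
    (\<forall>b\<in>Poly_Mapping.keys u. \<forall>m\<in>Poly_Mapping.keys (Poly_Mapping.lookup u b). m + \<alpha> b = \<gamma>)"

text \<open>
  \<open>graded_free_resolution B \<alpha> D J\<close>: the modules \<open>F\<^sub>k = free_module (B k)\<close>, graded by \<open>\<alpha>\<close>, with the maps
  \<open>F\<^sub>k\<^sub>+\<^sub>1 \<rightarrow> F\<^sub>k\<close> induced by \<open>D\<close> form an \<open>\<nat>\<^sup>n\<close>-graded free resolution of \<open>R/J\<close>
  in which \<open>F\<^sub>0 = R\<close> (one basis element, of multidegree 0) maps onto \<open>R/J\<close> canonically, so that
  exactness in degree 0 says that the image of \<open>F\<^sub>1\<close> in \<open>F\<^sub>0\<close> is \<open>J\<close>.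
\<close>

definition graded_free_resolution ::
    "(nat \<Rightarrow> 'b set) \<Rightarrow> ('b \<Rightarrow> 'n exponent) \<Rightarrow>
     (('b \<Rightarrow>\<^sub>0 ('n::finite, 'k::field) mpolynomial) \<Rightarrow> ('b \<Rightarrow>\<^sub>0 ('n, 'k) mpolynomial)) \<Rightarrow>
     ('n, 'k) mpolynomial set \<Rightarrow> bool"
  where "graded_free_resolution B \<alpha> D J \<longleftrightarrow>
    module_hom scale scale D \<and>
    (\<forall>k. \<forall>u\<in>free_module (B (Suc k)). D u \<in> free_module (B k)) \<and>
    (\<forall>k \<gamma>. \<forall>u\<in>free_module (B (Suc k)). homogeneous \<alpha> \<gamma> u \<longrightarrow> homogeneous \<alpha> \<gamma> (D u)) \<and>
    (\<forall>k. {u \<in> free_module (B (Suc k)). D u = 0} = D ` free_module (B (Suc (Suc k)))) \<and>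
    (\<exists>e. B 0 = {e} \<and> \<alpha> e = 0 \<and>
      D ` free_module (B (Suc 0)) = (\<lambda>p. Poly_Mapping.single e p) ` J)"

definition max_ideal :: "('n::finite, 'k::field) mpolynomial set"
  where "max_ideal = mono_ideal (range var_exp)"

text \<open>
  Minimality: \<open>D F\<^sub>k\<^sub>+\<^sub>1 \<subseteq> (x\<^sub>1, \<dots>, x\<^sub>n) F\<^sub>k\<close>. A resolution of \<open>R/J\<close> with \<open>F\<^sub>0 = R\<close> can only be minimal
  if \<open>J \<noteq> R\<close>; the dual of \<open>(x\<^sub>1\<^sup>d)\<close> with respect to \<open>(d, 0, \<dots>, 0)\<close> is \<open>R\<close>.
\<close>

definition minimal_complex ::
    "(nat \<Rightarrow> 'b set) \<Rightarrow>
     (('b \<Rightarrow>\<^sub>0 ('n::finite, 'k::field) mpolynomial) \<Rightarrow> ('b \<Rightarrow>\<^sub>0 ('n, 'k) mpolynomial)) \<Rightarrow> bool"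
  where "minimal_complex B D \<longleftrightarrow>
    (\<forall>k. \<forall>u\<in>free_module (B (Suc k)). \<forall>b. Poly_Mapping.lookup (D u) b \<in> max_ideal)"

subsection \<open>The cellular complex\<close>

definition boundary ::
    "'n exponent \<Rightarrow> ('n polyhedron \<Rightarrow>\<^sub>0 ('n::{finite,linorder}, 'k::field) mpolynomial) \<Rightarrow>
     ('n polyhedron \<Rightarrow>\<^sub>0 ('n, 'k) mpolynomial)"
  where "boundary a u = (\<Sum>P\<in>Poly_Mapping.keys u. \<Sum>Q\<in>facets_of P.
    Poly_Mapping.single Q
      (Poly_Mapping.lookup u P * of_int (incidence Q P) * xpow (label a P - label a Q)))"

end

theory Submission
  imports Defs
begin

text \<open>
  In the coordinates \<open>x \<mapsto> - (x\<^sub>k + \<dots> + x\<^sub>n)\<close> the cells \<open>C(f,\<sigma>)\<close> are boxes with unit sides, so that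
  \<open>\<partial>(f,\<sigma>) = \<Sum>\<plusminus>(x\<^sub>i (f,\<sigma> - i) - x\<^sub>i\<^sub>-\<^sub>1 (f \<rightarrow> i,\<sigma> - i))\<close>, summed over \<open>i \<in> \<sigma>\<close>.

  Exactness follows from a matching of the terms \<open>x\<^sup>m (f,\<sigma>)\<close>: if \<open>t\<close>, the least index of \<open>supp\<^sub>1 f\<close> with
  \<open>x\<^sub>t\<close> dividing \<open>x\<^sup>m\<close>, is smaller than all elements of \<open>\<sigma>\<close>, the boundary of \<open>(x\<^sup>m / x\<^sub>t) (f,\<sigma> \<union> t)\<close> rewrites
  the term into terms which are not of this kind and terms whose \<open>f\<close> is larger in the Borel order.
  By induction every chain is homologous to a chain of remaining (\<open>normal\<close>) terms. On normal chains the boundary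
  is injective: from a term \<open>x\<^sup>m (f,\<sigma>)\<close> with \<open>f\<close> of greatest weight, the term \<open>x\<^sup>m x\<^sub>t (f,\<sigma> - t)\<close> with
  \<open>t = min \<sigma>\<close> arises in no other way.
\<close>

section \<open>Faces of a box with unit sides\<close>

text \<open>Faces, labels and signs are defined through convex geometry, so the algebra can begin
  only once all facets and vertices of a cell are known. The coordinates suit this because trading
  x_i for x_(i-1) changes the sum x_k + ... + x_n for k = i only, by -1; the sign turns this into
  +1.

  Not all terms left over by the rewriting are normal. The other lower facets of the auxiliary cell
  are, because they keep t; upper facets may have to be reduced again, but each move lowers the
  weight, the sum of all j * f_j. The same weight decides injectivity: no upper facet can interfere
  with a term of greatest weight. A cycle is thus a boundary plus a normal cycle, and the latter is
  0.

  Vertices need an argument of their own, as nothing can be removed from the empty set. There the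
  common degree d is decisive: normality and the multidegree fix all exponents of f but that of the
  first variable, and the degree fixes that one. The common degree is also what makes the minimal
  generators stable under the moves.\<close>

definition indicator_vec :: "'n set \<Rightarrow> real^'n::finite"
  where "indicator_vec \<sigma> = (\<chi> i. if i \<in> \<sigma> then 1 else 0)"

definition unit_box :: "real^'n::finite \<Rightarrow> 'n set \<Rightarrow> (real^'n) set"
  where "unit_box q \<sigma> = cbox q (q + indicator_vec \<sigma>)"

lemma indicator_vec_nth [simp]: "indicator_vec \<sigma> $ i = (if i \<in> \<sigma> then 1 else 0)"
  by (simp add: indicator_vec_def)

lemma mem_unit_box:
  "x \<in> unit_box q \<sigma> \<longleftrightarrow> (\<forall>i. q $ i \<le> x $ i \<and> x $ i \<le> q $ i + (if i \<in> \<sigma> then 1 else 0))"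
  by (simp add: unit_box_def mem_box_cart)

lemma unit_box_nthD:
  assumes "x \<in> unit_box q \<sigma>"
  shows "q $ i \<le> x $ i" "x $ i \<le> q $ i + 1" "i \<notin> \<sigma> \<Longrightarrow> x $ i = q $ i"
  using assms[unfolded mem_unit_box, THEN spec[of _ i]] by (auto split: if_splits)

text \<open>The lower corner is the componentwise least point of a box, and the upper corner then
  shows which sides have length 1. This is why \<open>f\<close> and \<open>\<sigma>\<close> can be
  read off from a cell.\<close>

lemma unit_box_eq_iff [simp]:
  fixes p q :: "real^'n::finite"
  shows "unit_box p \<sigma> = unit_box q \<tau> \<longleftrightarrow> p = q \<and> \<sigma> = \<tau>"
proof
  assume eq: "unit_box p \<sigma> = unit_box q \<tau>"
  have self: "r \<in> unit_box r \<rho>" "r + indicator_vec \<rho> \<in> unit_box r \<rho>" for r :: "real^'n" and \<rho>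
    by (simp_all add: mem_unit_box)
  have p: "p \<in> unit_box q \<tau>" "p + indicator_vec \<sigma> \<in> unit_box q \<tau>"
    using self[of p \<sigma>] unfolding eq by blast+
  have q: "q \<in> unit_box p \<sigma>" "q + indicator_vec \<tau> \<in> unit_box p \<sigma>"
    using self[of q \<tau>] unfolding eq[symmetric] by blast+
  have "p = q"
    unfolding vec_eq_iff using unit_box_nthD(1)[OF p(1)] unit_box_nthD(1)[OF q(1)] by (simp add: antisym)
  moreover from this have "i \<in> \<sigma> \<longleftrightarrow> i \<in> \<tau>" for i
    using unit_box_nthD(3)[OF p(2), of i] unit_box_nthD(3)[OF q(2), of i] \<open>p = q\<close> by fastforce
  ultimately show "p = q \<and> \<sigma> = \<tau>" by blast
qed simp

text \<open>A coordinate strictly between its bounds leaves room to move both ways along its axis.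
  Conversely, if every coordinate is at a bound, a segment with the point inside must be constant in
  each coordinate.\<close>

lemma extreme_point_of_unit_box:
  "x extreme_point_of unit_box q \<sigma> \<longleftrightarrow> (\<exists>\<tau>\<subseteq>\<sigma>. x = q + indicator_vec \<tau>)"
proof
  assume x: "x extreme_point_of unit_box q \<sigma>"
  then have mem: "x \<in> unit_box q \<sigma>" by (simp add: extreme_point_of_def)
  have *: "x $ i = q $ i \<or> (i \<in> \<sigma> \<and> x $ i = q $ i + 1)" for i
  proof (rule ccontr)
    assume no: "\<not> ?thesis"
    have lt: "i \<in> \<sigma>" "q $ i < x $ i" "x $ i < q $ i + 1"
      using no mem[unfolded mem_unit_box, THEN spec[of _ i]] by (auto split: if_splits)
    \<comment> \<open>The smaller of the two distances to the bounds, so that both displaced points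
      stay in the box.\<close>
    define e where "e = min (x $ i - q $ i) (q $ i + 1 - x $ i)"
    have e: "0 < e" "e \<le> x $ i - q $ i" "e \<le> q $ i + 1 - x $ i" using lt by (auto simp: e_def)
    have "x - axis i e \<in> unit_box q \<sigma>" "x + axis i e \<in> unit_box q \<sigma>"
      using unit_box_nthD[OF mem] e lt by (auto simp: mem_unit_box axis_def)
    moreover have "x \<in> open_segment (x - axis i e) (x + axis i e)"
      using e midpoint_in_open_segment[of "x - axis i e" "x + axis i e"]
      by (simp add: midpoint_def vec_eq_iff axis_def)
    ultimately show False using x unfolding extreme_point_of_def by blast
  qed
  have "x = q + indicator_vec {i\<in>\<sigma>. x $ i \<noteq> q $ i}" using * by (force simp: vec_eq_iff)
  then show "\<exists>\<tau>\<subseteq>\<sigma>. x = q + indicator_vec \<tau>" by (intro exI[of _ "{i\<in>\<sigma>. x $ i \<noteq> q $ i}"]) auto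
next
  assume "\<exists>\<tau>\<subseteq>\<sigma>. x = q + indicator_vec \<tau>"
  then obtain \<tau> where \<tau>: "\<tau> \<subseteq> \<sigma>" "x = q + indicator_vec \<tau>" by blast
  show "x extreme_point_of unit_box q \<sigma>"
    unfolding extreme_point_of_def
  proof (intro conjI ballI)
    show "x \<in> unit_box q \<sigma>" using \<tau> by (auto simp: mem_unit_box)
    fix a b assume ab: "a \<in> unit_box q \<sigma>" "b \<in> unit_box q \<sigma>"
    show "x \<notin> open_segment a b"
    proof
      assume "x \<in> open_segment a b"
      then obtain u where u: "a \<noteq> b" "0 < u" "u < 1" "x = (1 - u) *\<^sub>R a + u *\<^sub>R b"
        by (auto simp: in_segment)
      have "a $ i = b $ i" for i
      proof -
        \<comment> \<open>Offsets of the two ends from the lower bound: they lie in [0,1], and a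
          proper weighted mean of them is 0 or 1 only if both are.\<close>
        define A where "A = a $ i - q $ i"
        define B where "B = b $ i - q $ i"
        have AB: "0 \<le> A" "0 \<le> B" "A \<le> 1" "B \<le> 1"
          using ab[unfolded mem_unit_box, THEN spec[of _ i]] by (auto simp: A_def B_def split: if_splits)
        have c: "(1 - u) * A + u * B = (if i \<in> \<tau> then 1 else 0)"
        proof -
          have "x $ i = (1 - u) * a $ i + u * b $ i" using u by simp
          then show ?thesis using \<tau>(2) by (simp add: A_def B_def algebra_simps)
        qed
        show ?thesis
        proof (cases "i \<in> \<tau>")
          case True
          then have "(1 - u) * (1 - A) + u * (1 - B) = 0" using c by (simp add: algebra_simps)
          moreover have "0 \<le> (1 - u) * (1 - A)" "0 \<le> u * (1 - B)" using AB u by auto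
          ultimately have "(1 - u) * (1 - A) = 0" "u * (1 - B) = 0" by linarith+
          then show ?thesis using u by (simp add: A_def B_def)
        next
          case False
          moreover have "0 \<le> (1 - u) * A" "0 \<le> u * B" using AB u by auto
          moreover have "(1 - u) * A + u * B = 0" using c False by (simp only: if_False)
          ultimately have "(1 - u) * A = 0" "u * B = 0" by linarith+
          then show ?thesis using u by (simp add: A_def B_def)
        qed
      qed
      then show False using u by (simp add: vec_eq_iff)
    qed
  qed
qed

lemma convex_hull_corners_unit_box:
  "convex hull ((\<lambda>\<tau>. q + indicator_vec \<tau>) ` Pow \<sigma>) = unit_box q \<sigma>"
proof -
  have "unit_box q \<sigma> = convex hull {x. x extreme_point_of unit_box q \<sigma>}"
    by (rule Krein_Milman_Minkowski) (simp_all add: unit_box_def)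
  moreover have "{x. x extreme_point_of unit_box q \<sigma>} = (\<lambda>\<tau>. q + indicator_vec \<tau>) ` Pow \<sigma>"
    by (auto simp: extreme_point_of_unit_box)
  ultimately show ?thesis by simp
qed

lemma unit_box_translation: "unit_box (c + q) \<sigma> = (+) c ` unit_box q \<sigma>"
  using cbox_translation[of c q "q + indicator_vec \<sigma>"] by (simp add: unit_box_def add.assoc)

text \<open>Translated to the origin, the box spans the same subspace as the axis vectors of its
  nondegenerate directions.\<close>

lemma aff_dim_unit_box [simp]:
  fixes q :: "real^'n::finite"
  shows "aff_dim (unit_box q \<sigma>) = int (card \<sigma>)"
proof -
  let ?A = "(\<lambda>i. axis i 1 :: real^'n) ` \<sigma>"
  have "aff_dim (unit_box q \<sigma>) = aff_dim (unit_box 0 \<sigma>)"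
    using unit_box_translation[of q 0 \<sigma>] by (simp add: aff_dim_translation_eq)
  also have "\<dots> = int (dim (unit_box 0 \<sigma> :: (real^'n) set))"
    by (rule aff_dim_zero) (rule hull_inc, simp add: mem_unit_box)
  also have "dim (unit_box 0 \<sigma> :: (real^'n) set) = dim ?A"
  proof (rule span_eq_dim, rule span_eq[THEN iffD2], rule conjI)
    show "unit_box 0 \<sigma> \<subseteq> span ?A"
    proof
      fix x :: "real^'n" assume x: "x \<in> unit_box 0 \<sigma>"
      have "x = (\<Sum>i\<in>\<sigma>. x $ i *\<^sub>R axis i 1)"
      proof (rule vec_eq_iff[THEN iffD2], rule allI)
        fix j
        have "(\<Sum>i\<in>\<sigma>. x $ i *\<^sub>R axis i 1) $ j = (\<Sum>i\<in>\<sigma>. if i = j then x $ i else 0)"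
          unfolding sum_component by (rule sum.cong) (auto simp: axis_def)
        also have "\<dots> = (if j \<in> \<sigma> then x $ j else 0)" by (subst sum.delta) simp_all
        also have "\<dots> = x $ j" using unit_box_nthD(3)[OF x, of j] by simp
        finally show "x $ j = (\<Sum>i\<in>\<sigma>. x $ i *\<^sub>R axis i 1) $ j" ..
      qed
      also have "\<dots> \<in> span ?A" by (intro span_sum span_scale span_base) blast
      finally show "x \<in> span ?A" .
    qed
    show "?A \<subseteq> span (unit_box 0 \<sigma>)"
      by (auto intro!: span_base simp: mem_unit_box axis_def)
  qed
  also have "dim ?A = card ?A"
  proof (rule dim_eq_card_independent, rule independent_mono[OF independent_Basis])
    show "?A \<subseteq> Basis" by (auto simp: Basis_vec_def)
  qed
  also have "card ?A = card \<sigma>" by (rule card_image) (auto simp: inj_on_def axis_eq_axis)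
  finally show ?thesis by simp
qed

section \<open>Facets of a box and their parallelism\<close>

lemma lower_face_of_unit_box:
  assumes "i \<in> \<sigma>"
  shows "unit_box q (\<sigma> - {i}) face_of unit_box q \<sigma>"
    and "unit_box q (\<sigma> - {i}) = {x\<in>unit_box q \<sigma>. x $ i = q $ i}"
proof -
  show eq: "unit_box q (\<sigma> - {i}) = {x\<in>unit_box q \<sigma>. x $ i = q $ i}"
  proof (rule set_eqI)
    fix x
    have "(q $ j \<le> x $ j \<and> x $ j \<le> q $ j + (if j \<in> \<sigma> - {i} then 1 else 0)) \<longleftrightarrow>
        (q $ j \<le> x $ j \<and> x $ j \<le> q $ j + (if j \<in> \<sigma> then 1 else 0)) \<and> (j = i \<longrightarrow> x $ i = q $ i)" for j
      by (cases "j = i") auto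
    then show "x \<in> unit_box q (\<sigma> - {i}) \<longleftrightarrow> x \<in> {x\<in>unit_box q \<sigma>. x $ i = q $ i}"
      unfolding mem_unit_box mem_Collect_eq by metis
  qed
  have "unit_box q \<sigma> \<inter> {x. axis i 1 \<bullet> x = q $ i} face_of unit_box q \<sigma>"
    by (rule face_of_Int_supporting_hyperplane_ge)
      (simp_all add: unit_box_def mem_box_cart inner_axis')
  moreover have "unit_box q \<sigma> \<inter> {x. axis i 1 \<bullet> x = q $ i} = {x\<in>unit_box q \<sigma>. x $ i = q $ i}"
    by (auto simp: inner_axis')
  ultimately show "unit_box q (\<sigma> - {i}) face_of unit_box q \<sigma>" using eq by simp
qed

lemma upper_face_of_unit_box:
  assumes "i \<in> \<sigma>"
  shows "unit_box (q + indicator_vec {i}) (\<sigma> - {i}) face_of unit_box q \<sigma>"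
    and "unit_box (q + indicator_vec {i}) (\<sigma> - {i}) = {x\<in>unit_box q \<sigma>. x $ i = q $ i + 1}"
proof -
  show eq: "unit_box (q + indicator_vec {i}) (\<sigma> - {i}) = {x\<in>unit_box q \<sigma>. x $ i = q $ i + 1}"
  proof (rule set_eqI)
    fix x
    have "(q $ j + (if j \<in> {i} then 1 else 0) \<le> x $ j \<and>
           x $ j \<le> q $ j + (if j \<in> {i} then 1 else 0) + (if j \<in> \<sigma> - {i} then 1 else 0)) \<longleftrightarrow>
        (q $ j \<le> x $ j \<and> x $ j \<le> q $ j + (if j \<in> \<sigma> then 1 else 0)) \<and> (j = i \<longrightarrow> x $ i = q $ i + 1)" for j
      using assms by (cases "j = i") auto
    then show "x \<in> unit_box (q + indicator_vec {i}) (\<sigma> - {i}) \<longleftrightarrow> x \<in> {x\<in>unit_box q \<sigma>. x $ i = q $ i + 1}"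
      unfolding mem_unit_box mem_Collect_eq vector_add_component indicator_vec_nth by metis
  qed
  have "unit_box q \<sigma> \<inter> {x. axis i 1 \<bullet> x = q $ i + 1} face_of unit_box q \<sigma>"
    using assms by (intro face_of_Int_supporting_hyperplane_le)
      (auto simp: unit_box_def mem_box_cart inner_axis' dest: spec[of _ i])
  moreover have "unit_box q \<sigma> \<inter> {x. axis i 1 \<bullet> x = q $ i + 1} = {x\<in>unit_box q \<sigma>. x $ i = q $ i + 1}"
    by (auto simp: inner_axis')
  ultimately show "unit_box (q + indicator_vec {i}) (\<sigma> - {i}) face_of unit_box q \<sigma>" using eq by simp
qed

text \<open>A relative interior point \<open>x\<close> of \<open>Q\<close> decides. Were it strictly
  between the bounds in all directions of \<open>\<sigma>\<close>, every other point
  \<open>y\<close> of the box would end a segment with \<open>x\<close> inside, and the face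
  property would put \<open>y\<close> into \<open>Q\<close>. So \<open>x\<close> lies on a lower or
  an upper face, which then contains all of \<open>Q\<close>.\<close>

lemma proper_face_of_unit_box:
  assumes Q: "Q face_of unit_box q \<sigma>" "Q \<noteq> {}" "Q \<noteq> unit_box q \<sigma>"
  shows "\<exists>i\<in>\<sigma>. Q \<subseteq> unit_box q (\<sigma> - {i}) \<or> Q \<subseteq> unit_box (q + indicator_vec {i}) (\<sigma> - {i})"
proof -
  have "rel_interior Q \<noteq> {}" using Q face_of_imp_convex rel_interior_eq_empty by blast
  then obtain x where x: "x \<in> rel_interior Q" by blast
  have xB: "x \<in> unit_box q \<sigma>" using x Q(1) rel_interior_subset face_of_imp_subset by blast
  have "\<exists>i\<in>\<sigma>. x $ i = q $ i \<or> x $ i = q $ i + 1"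
  proof (rule ccontr)
    assume no: "\<not> ?thesis"
    have strict: "q $ i < x $ i" "x $ i < q $ i + 1" if "i \<in> \<sigma>" for i
      using that no xB[unfolded mem_unit_box, THEN spec[of _ i]] by (auto simp: less_le)
    have "unit_box q \<sigma> \<subseteq> Q"
    proof
      fix y assume y: "y \<in> unit_box q \<sigma>"
      \<comment> \<open>The room around \<open>x\<close> in the directions of
        \<open>\<sigma>\<close>; the 1 keeps the minimum defined for empty \<open>\<sigma>\<close>.
        Coordinates of \<open>x\<close> and \<open>y\<close> differ by at most 1, so going
        \<open>d\<close> times \<open>x - y\<close> past \<open>x\<close> stays in the box.\<close>
      define d where "d = Min (insert 1 ((\<lambda>i. min (x $ i - q $ i) (q $ i + 1 - x $ i)) ` \<sigma>))"
      have d0: "0 < d" unfolding d_def by (subst Min_gr_iff) (auto simp: strict)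
      have d: "d \<le> x $ i - q $ i" "d \<le> q $ i + 1 - x $ i" if "i \<in> \<sigma>" for i
      proof -
        have "d \<le> min (x $ i - q $ i) (q $ i + 1 - x $ i)" using that unfolding d_def by (intro Min_le) auto
        then show "d \<le> x $ i - q $ i" "d \<le> q $ i + 1 - x $ i" by simp_all
      qed
      define z where "z = x + d *\<^sub>R (x - y)"
      have "z \<in> unit_box q \<sigma>"
        unfolding mem_unit_box
      proof
        fix i
        show "q $ i \<le> z $ i \<and> z $ i \<le> q $ i + (if i \<in> \<sigma> then 1 else 0)"
        proof (cases "i \<in> \<sigma>")
          case True
          have "\<bar>x $ i - y $ i\<bar> \<le> 1"
            using unit_box_nthD[OF xB, of i] unit_box_nthD[OF y, of i] by linarith
          then have "\<bar>d * (x $ i - y $ i)\<bar> \<le> d" using d0 by (simp add: abs_mult mult_le_cancel_left1)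
          then show ?thesis using True d[OF True] by (simp add: z_def abs_le_iff)
        next
          case False
          then have "x $ i = q $ i" "y $ i = q $ i"
            using unit_box_nthD(3)[OF xB] unit_box_nthD(3)[OF y] by auto
          then show ?thesis by (simp add: z_def)
        qed
      qed
      show "y \<in> Q"
      proof (cases "y = x")
        case True
        then show ?thesis using x rel_interior_subset by blast
      next
        case False
        have "x = (1 - 1 / (1 + d)) *\<^sub>R y + (1 / (1 + d)) *\<^sub>R z"
        proof -
          have "(1 + d) *\<^sub>R x = d *\<^sub>R y + z" by (simp add: z_def algebra_simps)
          then have "(1 / (1 + d)) *\<^sub>R ((1 + d) *\<^sub>R x) = (1 / (1 + d)) *\<^sub>R (d *\<^sub>R y + z)" by simp
          then have "x = (1 / (1 + d)) *\<^sub>R (d *\<^sub>R y + z)" using d0 by simp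
          moreover have "1 - 1 / (1 + d) = d / (1 + d)" using d0 by (simp add: field_simps)
          ultimately show ?thesis by (simp add: scaleR_add_right)
        qed
        moreover have "y \<noteq> z"
        proof
          assume "y = z"
          then have "(1 + d) *\<^sub>R (x - y) = 0" by (simp add: z_def algebra_simps)
          then show False using False d0 by simp
        qed
        ultimately have "x \<in> open_segment y z"
          using d0 unfolding in_segment by (intro conjI exI[of _ "1 / (1 + d)"]) (auto simp: field_simps)
        then show ?thesis
          using Q(1) x y \<open>z \<in> unit_box q \<sigma>\<close> rel_interior_subset unfolding face_of_def by blast
      qed
    qed
    then show False using Q face_of_imp_subset by blast
  qed
  then obtain i where i: "i \<in> \<sigma>" "x $ i = q $ i \<or> x $ i = q $ i + 1" by blast
  \<comment> \<open>A face that meets the relative interior of \<open>Q\<close> contains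
    \<open>Q\<close>.\<close>
  have sub: "Q \<subseteq> F" if "F face_of unit_box q \<sigma>" "x \<in> F" for F
    by (rule subset_of_face_of[OF that(1)]) (use Q(1) x that(2) face_of_imp_subset in blast)+
  show ?thesis
    using i(2) sub[OF lower_face_of_unit_box(1)[OF i(1)]] sub[OF upper_face_of_unit_box(1)[OF i(1)]]
      lower_face_of_unit_box(2)[OF i(1)] upper_face_of_unit_box(2)[OF i(1)] xB i(1) by blast
qed

lemma facets_of_unit_box:
  assumes "\<sigma> \<noteq> {}"
  shows "facets_of (unit_box q \<sigma>) =
    (\<Union>i\<in>\<sigma>. {unit_box q (\<sigma> - {i}), unit_box (q + indicator_vec {i}) (\<sigma> - {i})})" (is "_ = ?R")
proof
  have card: "int (card (\<sigma> - {i})) = int (card \<sigma>) - 1" if "i \<in> \<sigma>" for i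
    using that by (metis card_Suc_Diff1 finite of_nat_Suc add_diff_cancel_left')
  show "?R \<subseteq> facets_of (unit_box q \<sigma>)"
    using lower_face_of_unit_box(1) upper_face_of_unit_box(1) card by (auto simp: facets_of_def)
  show "facets_of (unit_box q \<sigma>) \<subseteq> ?R"
  proof
    fix Q assume "Q \<in> facets_of (unit_box q \<sigma>)"
    then have Q: "Q face_of unit_box q \<sigma>" "aff_dim Q = int (card \<sigma>) - 1" by (auto simp: facets_of_def)
    have "card \<sigma> > 0" using assms by (simp add: card_gt_0_iff)
    then have "Q \<noteq> {}" "Q \<noteq> unit_box q \<sigma>" using Q(2) by auto
    then obtain i F where i: "i \<in> \<sigma>" "Q \<subseteq> F" "F = unit_box q (\<sigma> - {i}) \<or> F = unit_box (q + indicator_vec {i}) (\<sigma> - {i})"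
      using proper_face_of_unit_box[OF Q(1)] by blast
    have "F face_of unit_box q \<sigma>" "aff_dim F = aff_dim Q"
      using i Q(2) card lower_face_of_unit_box(1) upper_face_of_unit_box(1) by auto
    \<comment> \<open>\<open>Q\<close> is also a face of \<open>F\<close>, and a proper face would
      have smaller dimension.\<close>
    then have "Q = F"
      by (metis Q(1) face_of_aff_dim_lt face_of_imp_convex face_of_imp_subset face_of_subset i(2) order_less_irrefl)
    then show "Q \<in> ?R" using i by blast
  qed
qed

lemma facets_of_singleton: "facets_of {p :: real^'n::finite} = {{}}"
  by (auto simp: facets_of_def aff_dim_empty[symmetric] )

text \<open>For \<open>i \<noteq> j\<close> the facet belonging to \<open>i\<close> contains a unit
  segment in direction \<open>j\<close>, whereas the one belonging to \<open>j\<close> lies in a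
  hyperplane orthogonal to that direction. This is what makes \<open>parallel_face\<close>
  unique.\<close>

lemma parallel_facets_unit_box:
  assumes i: "i \<in> \<sigma>" "F \<in> {unit_box q (\<sigma> - {i}), unit_box (q + indicator_vec {i}) (\<sigma> - {i})}"
    and j: "j \<in> \<sigma>" "Q \<in> {unit_box q (\<sigma> - {j}), unit_box (q + indicator_vec {j}) (\<sigma> - {j})}"
    and par: "affine_parallel (affine hull F) (affine hull Q)"
  shows "i = j"
proof (rule ccontr)
  assume ne: "i \<noteq> j"
  obtain p where p: "F = unit_box p (\<sigma> - {i})" using i by blast
  have FM: "p \<in> F" "p + axis j 1 \<in> F" using p ne j by (auto simp: mem_unit_box axis_def)
  obtain c where c: "Q \<subseteq> {x. axis j 1 \<bullet> x = c}"
    using j lower_face_of_unit_box(2)[OF j(1)] upper_face_of_unit_box(2)[OF j(1)] by (auto simp: inner_axis')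
  have hull: "affine hull Q \<subseteq> {x. axis j 1 \<bullet> x = c}"
    by (rule hull_minimal[where S="affine", OF c affine_hyperplane])
  obtain v where v: "affine hull Q = (\<lambda>x. v + x) ` (affine hull F)" using par by (auto simp: affine_parallel_def)
  have "v + p \<in> affine hull Q" "v + (p + axis j 1) \<in> affine hull Q"
    using FM hull_inc[of _ F affine] unfolding v by blast+
  then have "axis j 1 \<bullet> (v + p) = c" "axis j 1 \<bullet> (v + (p + axis j 1)) = c" using hull by blast+
  then have "(axis j 1 :: real^'a) \<bullet> axis j 1 = 0" by (simp add: inner_add_right)
  then show False by (simp add: inner_axis_axis)
qed

lemma affine_parallel_translated_box:
  "affine_parallel (affine hull (unit_box p \<sigma>)) (affine hull (unit_box (v + p) \<sigma>))"
proof -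
  have "affine hull (unit_box (v + p) \<sigma>) = (\<lambda>x. v + x) ` (affine hull (unit_box p \<sigma>))"
    unfolding unit_box_translation by (rule affine_hull_translation)
  then show ?thesis unfolding affine_parallel_def by blast
qed

section \<open>Geometry of the cells\<close>

text \<open>The integral form, without the sign, of the box coordinates. For monomials of equal
  degree, smaller tail sums mean larger in the Borel order.\<close>

definition tail_sum :: "'n::{finite,linorder} \<Rightarrow> 'n exponent \<Rightarrow> nat"
  where "tail_sum k f = (\<Sum>j | k \<le> j. f $ j)"

lemma var_exp_nth [simp]: "var_exp i $ j = (if j = i then 1 else 0)"
  by (simp add: var_exp_def axis_def)

lemma sum_var_exp_nth [simp]: "(\<Sum>i\<in>\<sigma>. var_exp i) $ k = (if k \<in> \<sigma> then 1 else 0)"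
  by (simp add: sum_component sum.delta)

lemma tail_sum_add: "tail_sum k (f + g) = tail_sum k f + tail_sum k g"
  by (simp add: tail_sum_def sum.distrib)

lemma tail_sum_sum: "tail_sum k (\<Sum>i\<in>A. f i) = (\<Sum>i\<in>A. tail_sum k (f i))"
  by (simp add: tail_sum_def sum_component sum.swap[of _ _ A])

lemma tail_sum_var_exp: "tail_sum k (var_exp i) = (if k \<le> i then 1 else 0)"
  by (simp add: tail_sum_def sum.delta)

text \<open>Tail sums are triangular: at the last index where two vectors differ, their tail sums
  differ too. This extracts that index, for exponents as well as for real vectors.\<close>

lemma greatest_nonzero_index:
  fixes P :: "'n::{finite,linorder} \<Rightarrow> bool"
  assumes "P i"
  obtains k where "P k" and "\<And>j. k < j \<Longrightarrow> \<not> P j"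
proof
  have "Max {i. P i} \<in> {i. P i}" using assms by (intro Max_in) auto
  then show "P (Max {i. P i})" by simp
  show "\<not> P j" if "Max {i. P i} < j" for j
    using that Max_ge[of "{i. P i}" j] by (auto simp: not_le[symmetric])
qed

lemma tail_sum_eqD:
  assumes "\<And>k. tail_sum k f = tail_sum k g"
  shows "f = g"
proof (rule ccontr)
  assume "f \<noteq> g"
  then obtain i where "f $ i \<noteq> g $ i" by (auto simp: vec_eq_iff)
  then obtain k where k: "f $ k \<noteq> g $ k" "\<And>j. k < j \<Longrightarrow> f $ j = g $ j"
    by (rule greatest_nonzero_index) auto
  have set: "{j. k \<le> j} = insert k {j. k < j}" by auto
  have "tail_sum k f = f $ k + (\<Sum>j | k < j. f $ j)" "tail_sum k g = g $ k + (\<Sum>j | k < j. g $ j)"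
    by (simp_all add: tail_sum_def set)
  moreover have "(\<Sum>j | k < j. f $ j) = (\<Sum>j | k < j. g $ j)" using k(2) by simp
  ultimately show False using assms[of k] k(1) by simp
qed

lemma less_iff_le_pred_index:
  fixes i :: "'n::{finite,linorder}"
  assumes "j < i"
  shows "k < i \<longleftrightarrow> k \<le> pred_index i"
proof
  show "k \<le> pred_index i" if "k < i" using that by (simp add: pred_index_def)
  have "pred_index i \<in> {j. j < i}" unfolding pred_index_def using assms by (intro Max_in) auto
  then show "k < i" if "k \<le> pred_index i" using that by auto
qed

lemma supp1_D:
  assumes "i \<in> supp1 f"
  shows "0 < f $ i" and "k < i \<longleftrightarrow> k \<le> pred_index i" and "pred_index i < i"
  using assms less_iff_le_pred_index[of _ i] by (auto simp: supp1_def)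

text \<open>Inside \<open>supp1 f\<close> the subtraction in \<open>move\<close> is not truncated.
  Later exponent identities are drawn from this additive form.\<close>

lemma move_add_var_exp:
  assumes "\<sigma> \<subseteq> supp1 f"
  shows "move f \<sigma> + (\<Sum>i\<in>\<sigma>. var_exp i) = f + (\<Sum>i\<in>\<sigma>. var_exp (pred_index i))"
proof -
  have "(\<Sum>i\<in>\<sigma>. var_exp i) $ k \<le> f $ k" for k
    using assms supp1_D(1)[of k f] by (auto simp: Suc_le_eq)
  then show ?thesis
    unfolding move_def vec_eq_iff vector_add_component vector_minus_component by (simp add: trans_le_add1)
qed

lemma tail_sum_move:
  assumes "\<sigma> \<subseteq> supp1 f"
  shows "tail_sum k (move f \<sigma>) + (if k \<in> \<sigma> then 1 else 0) = tail_sum k f"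
proof -
  have "tail_sum k (move f \<sigma>) + (\<Sum>i\<in>\<sigma>. if k \<le> i then 1 else 0)
      = tail_sum k f + (\<Sum>i\<in>\<sigma>. if k \<le> pred_index i then 1 else 0)"
    using arg_cong[OF move_add_var_exp[OF assms], of "tail_sum k"]
    by (simp add: tail_sum_add tail_sum_sum tail_sum_var_exp)
  \<comment> \<open>\<open>k \<le> i\<close> and \<open>k \<le> pred_index i\<close> differ only at
    \<open>k = i\<close>, so each index of \<open>\<sigma>\<close> affects exactly its own tail
    sum.\<close>
  moreover have "(\<Sum>i\<in>\<sigma>. if k \<le> i then 1 else 0 :: nat)
      = (\<Sum>i\<in>\<sigma>. (if k \<le> pred_index i then 1 else 0) + (if k = i then 1 else 0))"
    by (rule sum.cong) (use assms supp1_D(2) in \<open>force+\<close>)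
  moreover have "\<dots> = (\<Sum>i\<in>\<sigma>. if k \<le> pred_index i then 1 else 0) + (if k \<in> \<sigma> then 1 else 0)"
    by (simp add: sum.distrib sum.delta')
  ultimately show ?thesis by linarith
qed

lemma move_empty [simp]: "move f {} = f"
  by (simp add: move_def)

lemma move_nth_ge:
  assumes "\<sigma> \<subseteq> supp1 f"
  shows "f $ k \<le> move f \<sigma> $ k + (if k \<in> \<sigma> then 1 else 0)"
  using arg_cong[OF move_add_var_exp[OF assms], of "\<lambda>v. v $ k"] by simp

text \<open>A move lowers exponents only at indices of \<open>\<sigma>\<close> and may raise others,
  so the remaining indices can still be moved.\<close>

lemma supp1_move:
  assumes "\<sigma> \<subseteq> supp1 f"
  shows "supp1 f - \<sigma> \<subseteq> supp1 (move f \<sigma>)"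
  using move_nth_ge[OF assms] by (fastforce simp: supp1_def dest: order.strict_trans2)

lemma move_move:
  assumes "\<sigma> \<union> \<tau> \<subseteq> supp1 f" "\<sigma> \<inter> \<tau> = {}"
  shows "move (move f \<sigma>) \<tau> = move f (\<sigma> \<union> \<tau>)"
proof (rule tail_sum_eqD)
  fix k
  have "\<sigma> \<subseteq> supp1 f" "\<tau> \<subseteq> supp1 (move f \<sigma>)" using supp1_move[of \<sigma> f] assms by blast+
  from tail_sum_move[OF this(1), of k] tail_sum_move[OF this(2), of k] tail_sum_move[OF assms(1), of k] assms(2)
  show "tail_sum k (move (move f \<sigma>) \<tau>) = tail_sum k (move f (\<sigma> \<union> \<tau>))" by (auto split: if_splits)
qed

lemma move_eq_iff:
  assumes "\<sigma> \<subseteq> supp1 f" "\<tau> \<subseteq> supp1 f"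
  shows "move f \<sigma> = move f \<tau> \<longleftrightarrow> \<sigma> = \<tau>"
proof
  assume "move f \<sigma> = move f \<tau>"
  then have "k \<in> \<sigma> \<longleftrightarrow> k \<in> \<tau>" for k
    using tail_sum_move[OF assms(1), of k] tail_sum_move[OF assms(2), of k] by (auto split: if_splits)
  then show "\<sigma> = \<tau>" by blast
qed simp

text \<open>In these coordinates, \<open>m \<mapsto> (m \<rightarrow> \<sigma>)\<close> is the translation by the indicator vector of \<open>\<sigma>\<close>, so the
  cells become boxes.\<close>

definition tail_coords :: "(real, 'n::{finite,linorder}) vec \<Rightarrow> (real, 'n) vec"
  where "tail_coords x = (\<chi> k. - (\<Sum>j | k \<le> j. x $ j))"

lemma linear_tail_coords: "linear tail_coords"
  by (rule linearI) (simp_all add: tail_coords_def vec_eq_iff sum.distrib sum_distrib_left)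

lemma inj_tail_coords: "inj tail_coords"
  unfolding linear_injective_0[OF linear_tail_coords]
proof (intro allI impI)
  fix x :: "(real, 'a) vec"
  assume 0: "tail_coords x = 0"
  show "x = 0"
  proof (rule ccontr)
    assume "x \<noteq> 0"
    then obtain i where "x $ i \<noteq> 0" by (auto simp: vec_eq_iff)
    then obtain k where k: "x $ k \<noteq> 0" "\<And>j. k < j \<Longrightarrow> x $ j = 0"
      by (rule greatest_nonzero_index) auto
    have "{j. k \<le> j} = insert k {j. k < j}" by auto
    then have "(\<Sum>j | k \<le> j. x $ j) = x $ k" using k(2) by simp
    moreover have "(\<Sum>j | k \<le> j. x $ j) = 0"
      using arg_cong[OF 0, of "\<lambda>v. v $ k"] by (simp add: tail_coords_def)
    ultimately show False using k(1) by simp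
  qed
qed

lemma tail_coords_point: "tail_coords (point f) $ k = - real (tail_sum k f)"
  by (simp add: tail_coords_def point_def tail_sum_def)

lemma tail_coords_point_eq_iff: "tail_coords (point f) = tail_coords (point g) \<longleftrightarrow> f = g"
proof
  assume "tail_coords (point f) = tail_coords (point g)"
  then have "tail_sum k f = tail_sum k g" for k using tail_coords_point[of f k] tail_coords_point[of g k] by simp
  then show "f = g" by (rule tail_sum_eqD)
qed simp

lemma tail_coords_move:
  assumes "\<sigma> \<subseteq> supp1 f"
  shows "tail_coords (point (move f \<sigma>)) = tail_coords (point f) + indicator_vec \<sigma>"
proof -
  have "- real (tail_sum k (move f \<sigma>)) = - real (tail_sum k f) + (if k \<in> \<sigma> then 1 else 0)" for k
    using tail_sum_move[OF assms, of k] by (auto split: if_splits)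
  then show ?thesis by (simp add: vec_eq_iff tail_coords_point)
qed

section \<open>Dimension, vertices, facets and labels of a cell\<close>

lemma tail_coords_cell:
  assumes "\<sigma> \<subseteq> supp1 f"
  shows "tail_coords ` cell f \<sigma> = unit_box (tail_coords (point f)) \<sigma>"
proof -
  have "tail_coords ` (\<lambda>\<tau>. point (move f \<tau>)) ` Pow \<sigma>
      = (\<lambda>\<tau>. tail_coords (point f) + indicator_vec \<tau>) ` Pow \<sigma>"
    unfolding image_image using assms by (intro image_cong refl tail_coords_move) blast
  then show ?thesis
    by (simp add: cell_def convex_hull_linear_image[OF linear_tail_coords] convex_hull_corners_unit_box)
qed

lemma cell_eq_iff:
  assumes "\<sigma> \<subseteq> supp1 f" "\<tau> \<subseteq> supp1 g"
  shows "cell f \<sigma> = cell g \<tau> \<longleftrightarrow> f = g \<and> \<sigma> = \<tau>"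
proof -
  have "cell f \<sigma> = cell g \<tau> \<longleftrightarrow> tail_coords ` cell f \<sigma> = tail_coords ` cell g \<tau>"
    by (rule inj_image_eq_iff[OF inj_tail_coords, symmetric])
  then show ?thesis by (simp add: tail_coords_cell assms tail_coords_point_eq_iff)
qed

lemma cell_not_empty [simp]: "cell f \<sigma> \<noteq> {}"
  by (auto simp: cell_def)

lemma cell_singleton: "cell f {} = {point f}"
  by (simp add: cell_def)

lemma aff_dim_cell:
  assumes "\<sigma> \<subseteq> supp1 f"
  shows "aff_dim (cell f \<sigma>) = int (card \<sigma>)"
  using aff_dim_injective_linear_image[OF linear_tail_coords inj_tail_coords, of "cell f \<sigma>"]
  by (simp add: tail_coords_cell assms)

lemma point_eq_iff [simp]: "point f = point g \<longleftrightarrow> f = g"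
  by (simp add: point_def vec_eq_iff)

lemma point_extreme_point_of_cell:
  assumes "\<sigma> \<subseteq> supp1 f"
  shows "point g extreme_point_of cell f \<sigma> \<longleftrightarrow> (\<exists>\<tau>\<subseteq>\<sigma>. g = move f \<tau>)"
proof -
  have "point g extreme_point_of cell f \<sigma>
      \<longleftrightarrow> tail_coords (point g) extreme_point_of unit_box (tail_coords (point f)) \<sigma>"
    using face_of_linear_image[OF linear_tail_coords inj_tail_coords, of "{point g}" "cell f \<sigma>"]
    by (simp add: tail_coords_cell assms face_of_singleton)
  also have "\<dots> \<longleftrightarrow> (\<exists>\<tau>\<subseteq>\<sigma>. tail_coords (point g) = tail_coords (point (move f \<tau>)))"
    unfolding extreme_point_of_unit_box using assms tail_coords_move by (metis subset_trans)
  finally show ?thesis by (simp add: tail_coords_point_eq_iff)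
qed

lemma facets_of_linear_image:
  fixes L :: "real^'n::finite \<Rightarrow> real^'n"
  assumes "linear L" "inj L"
  shows "L ` Q \<in> facets_of (L ` P) \<longleftrightarrow> Q \<in> facets_of P"
  by (simp add: facets_of_def face_of_linear_image aff_dim_injective_linear_image assms)

text \<open>Shifting the box by the indicator vector of \<open>{i}\<close> corresponds to passing to
  \<open>move f {i}\<close>, so opposite facets belong to different monomials.\<close>

lemma facets_of_cell:
  assumes \<sigma>: "\<sigma> \<subseteq> supp1 f" "\<sigma> \<noteq> {}"
  shows "facets_of (cell f \<sigma>) = (\<Union>i\<in>\<sigma>. {cell f (\<sigma> - {i}), cell (move f {i}) (\<sigma> - {i})})"
proof -
  let ?L = "tail_coords :: (real, 'a) vec \<Rightarrow> (real, 'a) vec"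
  have faces: "?L ` cell f (\<sigma> - {i}) = unit_box (?L (point f)) (\<sigma> - {i})"
    "?L ` cell (move f {i}) (\<sigma> - {i}) = unit_box (?L (point f) + indicator_vec {i}) (\<sigma> - {i})"
    if "i \<in> \<sigma>" for i
  proof -
    have sub: "\<sigma> - {i} \<subseteq> supp1 f" "{i} \<subseteq> supp1 f" "\<sigma> - {i} \<subseteq> supp1 (move f {i})"
      using \<sigma> that supp1_move[of "{i}" f] by auto
    show "?L ` cell f (\<sigma> - {i}) = unit_box (?L (point f)) (\<sigma> - {i})"
      by (rule tail_coords_cell[OF sub(1)])
    show "?L ` cell (move f {i}) (\<sigma> - {i}) = unit_box (?L (point f) + indicator_vec {i}) (\<sigma> - {i})"
      unfolding tail_coords_cell[OF sub(3)] tail_coords_move[OF sub(2)] ..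
  qed
  have "Q \<in> facets_of (cell f \<sigma>) \<longleftrightarrow>
      (\<exists>i\<in>\<sigma>. Q = cell f (\<sigma> - {i}) \<or> Q = cell (move f {i}) (\<sigma> - {i}))" for Q
  proof -
    have "Q \<in> facets_of (cell f \<sigma>) \<longleftrightarrow> ?L ` Q \<in> facets_of (unit_box (?L (point f)) \<sigma>)"
      using facets_of_linear_image[OF linear_tail_coords inj_tail_coords, of Q "cell f \<sigma>"]
      by (simp add: tail_coords_cell \<sigma>(1))
    also have "\<dots> \<longleftrightarrow> (\<exists>i\<in>\<sigma>. ?L ` Q = ?L ` cell f (\<sigma> - {i}) \<or> ?L ` Q = ?L ` cell (move f {i}) (\<sigma> - {i}))"
      unfolding facets_of_unit_box[OF \<sigma>(2)] using faces by auto
    also have "\<dots> \<longleftrightarrow> (\<exists>i\<in>\<sigma>. Q = cell f (\<sigma> - {i}) \<or> Q = cell (move f {i}) (\<sigma> - {i}))"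
      by (simp add: inj_image_eq_iff[OF inj_tail_coords])
    finally show ?thesis .
  qed
  then show ?thesis by blast
qed

lemma facets_of_vertex: "facets_of (cell f {}) = {{}}"
  by (simp add: cell_singleton facets_of_singleton)

lemma label_empty [simp]: "label a {} = 0"
  by (simp add: label_def mono_lcm_def extreme_point_of_def vec_eq_iff)

text \<open>The lcm has to be evaluated where the exponent of x_k in \<open>move f \<tau>\<close> is
  least. A move takes away at most one factor x_k, and only if
  \<open>k \<in> \<tau>\<close>.\<close>

lemma label_cell:
  assumes \<sigma>: "\<sigma> \<subseteq> supp1 f" and "f \<le> a"
  shows "label a (cell f \<sigma>) = a - f + (\<Sum>i\<in>\<sigma>. var_exp i)"
  unfolding vec_eq_iff
proof
  fix k
  let ?r = "(a - f + (\<Sum>i\<in>\<sigma>. var_exp i)) $ k"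
  have "label a (cell f \<sigma>) $ k = Max (insert 0 ((\<lambda>m. m $ k) ` {a - g |g. \<exists>\<tau>\<subseteq>\<sigma>. g = move f \<tau>}))"
    by (simp add: label_def mono_lcm_def point_extreme_point_of_cell[OF \<sigma>])
  also have "{a - g |g. \<exists>\<tau>\<subseteq>\<sigma>. g = move f \<tau>} = (\<lambda>\<tau>. a - move f \<tau>) ` Pow \<sigma>" by auto
  also have "(\<lambda>m. m $ k) ` (\<lambda>\<tau>. a - move f \<tau>) ` Pow \<sigma> = (\<lambda>\<tau>. a $ k - move f \<tau> $ k) ` Pow \<sigma>"
    by (simp add: image_image)
  also have "Max (insert 0 ((\<lambda>\<tau>. a $ k - move f \<tau> $ k) ` Pow \<sigma>)) = ?r"
  proof (rule Max_eqI)
    show "finite (insert 0 ((\<lambda>\<tau>. a $ k - move f \<tau> $ k) ` Pow \<sigma>))" by simp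
    have fa: "f $ k \<le> a $ k" using assms(2) by (simp add: less_eq_vec_def)
    show "y \<le> ?r" if "y \<in> insert 0 ((\<lambda>\<tau>. a $ k - move f \<tau> $ k) ` Pow \<sigma>)" for y
    proof -
      from that consider "y = 0" | \<tau> where "\<tau> \<subseteq> \<sigma>" "y = a $ k - move f \<tau> $ k" by auto
      then show ?thesis
      proof cases
        case 2
        then have "f $ k \<le> move f \<tau> $ k + (if k \<in> \<tau> then 1 else 0)" using move_nth_ge[of \<tau> f k] \<sigma> by blast
        then show ?thesis using 2 fa by (auto split: if_splits)
      qed simp
    qed
    show "?r \<in> insert 0 ((\<lambda>\<tau>. a $ k - move f \<tau> $ k) ` Pow \<sigma>)"
    proof (cases "k \<in> \<sigma>")
      case True
      \<comment> \<open>The maximum is attained at \<open>{k}\<close>; at \<open>\<sigma>\<close>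
        itself, the successor of \<open>k\<close> may give the factor x_k back.\<close>
      then have "{k} \<subseteq> supp1 f" using \<sigma> by blast
      from arg_cong[OF move_add_var_exp[OF this], of "\<lambda>v. v $ k"] supp1_D(3)[of k f] this
      have "move f {k} $ k + 1 = f $ k" by auto
      then have "?r = a $ k - move f {k} $ k" using True fa by simp
      then show ?thesis using True by blast
    next
      case False
      then have "?r = a $ k - move f {} $ k" by simp
      then show ?thesis by blast
    qed
  qed
  finally show "label a (cell f \<sigma>) $ k = ?r" .
qed

section \<open>Incidence numbers of a cell\<close>

lemma near_incidence_cell:
  assumes "\<sigma> \<subseteq> supp1 f"
  shows "near_incidence Q (cell f \<sigma>) e \<longleftrightarrow>
    (\<exists>i\<in>\<sigma>. Q = cell f (\<sigma> - {i}) \<and> e = (-1) ^ card {j\<in>\<sigma>. j < i})"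
  unfolding near_incidence_def using assms cell_eq_iff by blast

lemma near_incidence_lower:
  assumes "\<sigma> \<subseteq> supp1 f" "i \<in> \<sigma>"
  shows "near_incidence (cell f (\<sigma> - {i})) (cell f \<sigma>) e \<longleftrightarrow> e = (-1) ^ card {j\<in>\<sigma>. j < i}"
proof -
  have "cell f (\<sigma> - {i}) = cell f (\<sigma> - {j}) \<longleftrightarrow> i = j" if "j \<in> \<sigma>" for j
    using assms that by (subst cell_eq_iff) auto
  then show ?thesis unfolding near_incidence_cell[OF assms(1)] using assms(2) by blast
qed

lemma incidence_lower:
  assumes "\<sigma> \<subseteq> supp1 f" "i \<in> \<sigma>"
  shows "incidence (cell f (\<sigma> - {i})) (cell f \<sigma>) = (-1) ^ card {j\<in>\<sigma>. j < i}"
  unfolding incidence_def near_incidence_lower[OF assms] by simp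

lemma affine_parallel_linear_image:
  fixes L :: "real^'n::finite \<Rightarrow> real^'n"
  assumes L: "linear L" and "affine_parallel (affine hull F) (affine hull Q)"
  shows "affine_parallel (affine hull (L ` F)) (affine hull (L ` Q))"
proof -
  obtain v where "affine hull Q = (\<lambda>x. v + x) ` (affine hull F)" using assms(2) by (auto simp: affine_parallel_def)
  then have "L ` (affine hull Q) = (\<lambda>x. L v + x) ` L ` (affine hull F)"
    by (simp add: image_image linear_add[OF L])
  then show ?thesis
    using affine_hull_linear_image[OF linear_conv_bounded_linear[THEN iffD1, OF L]]
    unfolding affine_parallel_def by metis
qed

text \<open>Opposite facets of a box are translates of each other, which gives existence; uniqueness
  is that of parallel facets in a given direction. Parallelism reaches the cell through the inverse
  of the coordinate map and returns through the map itself.\<close>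

lemma parallel_face_upper:
  assumes \<sigma>: "\<sigma> \<subseteq> supp1 f" "i \<in> \<sigma>"
  shows "parallel_face (cell (move f {i}) (\<sigma> - {i})) (cell f \<sigma>) = cell f (\<sigma> - {i})" (is "parallel_face ?U ?P = ?D")
  unfolding parallel_face_def
proof (rule the_equality)
  let ?L = "tail_coords :: (real, 'a) vec \<Rightarrow> (real, 'a) vec"
  let ?q = "?L (point f)"
  have sub: "\<sigma> - {j} \<subseteq> supp1 f" "{j} \<subseteq> supp1 f" "\<sigma> - {j} \<subseteq> supp1 (move f {j})" if "j \<in> \<sigma>" for j
    using \<sigma> that supp1_move[of "{j}" f] by auto
  have LD: "?L ` cell f (\<sigma> - {j}) = unit_box ?q (\<sigma> - {j})" if "j \<in> \<sigma>" for j
    by (rule tail_coords_cell[OF sub(1)[OF that]])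
  have LU: "?L ` cell (move f {j}) (\<sigma> - {j}) = unit_box (?q + indicator_vec {j}) (\<sigma> - {j})" if "j \<in> \<sigma>" for j
    unfolding tail_coords_cell[OF sub(3)[OF that]] tail_coords_move[OF sub(2)[OF that]] ..
  have facets: "facets_of ?P = (\<Union>i\<in>\<sigma>. {cell f (\<sigma> - {i}), cell (move f {i}) (\<sigma> - {i})})"
    using \<sigma> by (intro facets_of_cell) auto
  have dims: "aff_dim ?D = aff_dim ?U" "aff_dim ?U = aff_dim ?P - 1"
    using \<sigma> sub[OF \<sigma>(2)] by (simp_all add: aff_dim_cell of_nat_diff card_gt_0_iff Suc_le_eq)
      (metis One_nat_def Suc_leI card_gt_0_iff empty_iff finite of_nat_diff of_nat_1)
  have inv: "inv ?L ` ?L ` A = A" for A by (rule image_inv_f_f[OF inj_tail_coords])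
  have lin: "linear (inv ?L)"
    by (rule inj_linear_imp_inv_linear[OF linear_tail_coords inj_tail_coords])
  have "?D face_of ?P" using facets \<sigma>(2) by (auto simp: facets_of_def)
  moreover have "?D \<noteq> ?U"
    using sub[OF \<sigma>(2)] move_eq_iff[of "{}" f "{i}"] by (subst cell_eq_iff) auto
  moreover have "affine_parallel (affine hull ?D) (affine hull ?U)"
    using affine_parallel_linear_image[OF lin affine_parallel_translated_box[of ?q "\<sigma> - {i}" "indicator_vec {i}"]]
    by (simp only: add.commute[of "indicator_vec {i}"] LD[OF \<sigma>(2), symmetric] LU[OF \<sigma>(2), symmetric] inv)
  ultimately show "?D face_of ?P \<and> ?D \<noteq> ?U \<and> aff_dim ?D = aff_dim ?U \<and>
    affine_parallel (affine hull ?D) (affine hull ?U)" using dims by simp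
  fix F assume F: "F face_of ?P \<and> F \<noteq> ?U \<and> aff_dim F = aff_dim ?U \<and>
    affine_parallel (affine hull F) (affine hull ?U)"
  then have "F \<in> facets_of ?P" using dims by (simp add: facets_of_def)
  then obtain j where j: "j \<in> \<sigma>" "F = cell f (\<sigma> - {j}) \<or> F = cell (move f {j}) (\<sigma> - {j})"
    unfolding facets by blast
  have "j = i"
  proof (rule parallel_facets_unit_box[OF j(1) _ \<sigma>(2)])
    show "?L ` F \<in> {unit_box ?q (\<sigma> - {j}), unit_box (?q + indicator_vec {j}) (\<sigma> - {j})}"
      using j(2) LD[OF j(1)] LU[OF j(1)] by (elim disjE) simp_all
    show "?L ` ?U \<in> {unit_box ?q (\<sigma> - {i}), unit_box (?q + indicator_vec {i}) (\<sigma> - {i})}"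
      using LU[OF \<sigma>(2)] by simp
    show "affine_parallel (affine hull (?L ` F)) (affine hull (?L ` ?U))"
      using F by (intro affine_parallel_linear_image linear_tail_coords) simp
  qed
  then show "F = ?D" using j F by blast
qed

text \<open>The monomial of an upper facet differs from \<open>f\<close>, so the facet never
  satisfies \<open>near_incidence\<close>, and the definition passes to the opposite facet with
  reversed sign.\<close>

lemma incidence_upper:
  assumes \<sigma>: "\<sigma> \<subseteq> supp1 f" "i \<in> \<sigma>"
  shows "incidence (cell (move f {i}) (\<sigma> - {i})) (cell f \<sigma>) = - ((-1) ^ card {j\<in>\<sigma>. j < i})"
proof -
  have ne: "f \<noteq> move f {i}" using \<sigma> move_eq_iff[of "{}" f "{i}"] by auto
  have "\<sigma> - {i} \<subseteq> supp1 (move f {i})" using \<sigma> supp1_move[of "{i}" f] by auto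
  then have "cell (move f {i}) (\<sigma> - {i}) \<noteq> cell f (\<sigma> - {j})" for j
    using \<sigma> ne by (subst cell_eq_iff) auto
  then have no: "\<not> (\<exists>e. near_incidence (cell (move f {i}) (\<sigma> - {i})) (cell f \<sigma>) e)"
    unfolding near_incidence_cell[OF \<sigma>(1)] by blast
  then show ?thesis
    unfolding incidence_def if_not_P[OF cell_not_empty] if_not_P[OF no] parallel_face_upper[OF assms]
      near_incidence_lower[OF assms] by simp
qed

section \<open>The boundary map\<close>

lemma poly_mapping_eq_sum_single: "u = (\<Sum>b\<in>Poly_Mapping.keys u. Poly_Mapping.single b (Poly_Mapping.lookup u b))"
  by (rule poly_mapping_eqI) (simp add: lookup_sum lookup_single when_def sum.delta in_keys_iff)

lemma single_sum: "Poly_Mapping.single b (\<Sum>i\<in>A. f i) = (\<Sum>i\<in>A. Poly_Mapping.single b (f i))"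
  by (induction A rule: infinite_finite_induct) (simp_all add: single_add)

lemma lookup_mult_xpow:
  "Poly_Mapping.lookup (p * xpow v) n = (if v \<le> n then Poly_Mapping.lookup p (n - v) else 0)"
proof -
  have eq: "k + v = n \<longleftrightarrow> v \<le> n \<and> k = n - v" for k
  proof -
    have "k $ i + v $ i = n $ i \<longleftrightarrow> v $ i \<le> n $ i \<and> k $ i = n $ i - v $ i" for i by auto
    then show ?thesis by (simp add: vec_eq_iff less_eq_vec_def all_conj_distrib)
  qed
  have "p * xpow v = (\<Sum>k\<in>Poly_Mapping.keys p. Poly_Mapping.single (k + v) (Poly_Mapping.lookup p k))"
    by (subst (1) poly_mapping_eq_sum_single[of p]) (simp add: sum_distrib_right xpow_def mult_single)
  then show ?thesis
    by (simp add: lookup_sum lookup_single when_def eq in_keys_iff sum.delta)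
qed

lemma lookup_mult_sign:
  "Poly_Mapping.lookup (p * (-1) ^ k) n = (-1) ^ k * Poly_Mapping.lookup (p :: ('n::finite, 'k::field) mpolynomial) n"
  by (induction k) (simp_all add: algebra_simps)

lemma lookup_scale: "Poly_Mapping.lookup (scale r u) b = r * Poly_Mapping.lookup u b"
  by (simp add: scale_def Poly_Mapping.map.rep_eq when_def)

lemma free_module_0 [simp]: "0 \<in> free_module B"
  by (simp add: free_module_def)

lemma free_module_add: "u \<in> free_module B \<Longrightarrow> v \<in> free_module B \<Longrightarrow> u + v \<in> free_module B"
  using Poly_Mapping.keys_add[of u v] by (auto simp: free_module_def)

lemma free_module_diff:
  fixes u v :: "'b \<Rightarrow>\<^sub>0 'r::ab_group_add"
  assumes "u \<in> free_module B" "v \<in> free_module B"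
  shows "u - v \<in> free_module B"
proof -
  have "Poly_Mapping.keys (u - v) \<subseteq> Poly_Mapping.keys u \<union> Poly_Mapping.keys v"
    by (auto simp: in_keys_iff lookup_minus)
  then show ?thesis using assms by (auto simp: free_module_def)
qed

lemma free_module_sum: "(\<And>i. i \<in> A \<Longrightarrow> u i \<in> free_module B) \<Longrightarrow> (\<Sum>i\<in>A. u i) \<in> free_module B"
  by (induction A rule: infinite_finite_induct) (auto intro: free_module_add)

lemma free_module_single [simp]: "b \<in> B \<Longrightarrow> Poly_Mapping.single b p \<in> free_module B"
  by (auto simp: free_module_def)

definition cell_boundary ::
    "'n exponent \<Rightarrow> 'n polyhedron \<Rightarrow> ('n::{finite,linorder}, 'k::field) mpolynomial \<Rightarrow>
     ('n polyhedron \<Rightarrow>\<^sub>0 ('n, 'k) mpolynomial)"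
  where "cell_boundary a P p = (\<Sum>Q\<in>facets_of P.
    Poly_Mapping.single Q (p * of_int (incidence Q P) * xpow (label a P - label a Q)))"

lemma cell_boundary_0 [simp]: "cell_boundary a P 0 = 0"
  by (simp add: cell_boundary_def)

lemma cell_boundary_add: "cell_boundary a P (p + q) = cell_boundary a P p + cell_boundary a P q"
  by (simp add: cell_boundary_def sum.distrib single_add distrib_right)

lemma cell_boundary_mult: "cell_boundary a P (r * p) = scale r (cell_boundary a P p)"
  by (rule poly_mapping_eqI)
    (simp add: cell_boundary_def lookup_scale lookup_sum lookup_single when_def sum_distrib_left mult.assoc if_distrib cong: if_cong)

text \<open>The support of a sum may shrink by cancellation. A finite superset serves as common
  index set, which is how linearity is obtained.\<close>

lemma boundary_eq_sum_superset:
  assumes "finite A" "Poly_Mapping.keys u \<subseteq> A"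
  shows "boundary a u = (\<Sum>P\<in>A. cell_boundary a P (Poly_Mapping.lookup u P))"
  unfolding boundary_def cell_boundary_def[symmetric]
  by (rule sum.mono_neutral_left[OF assms]) (simp add: in_keys_iff)

lemma boundary_add: "boundary a (u + v) = boundary a u + boundary a v"
proof -
  let ?A = "Poly_Mapping.keys u \<union> Poly_Mapping.keys v"
  have "Poly_Mapping.keys (u + v) \<subseteq> ?A" by (rule Poly_Mapping.keys_add)
  then have "boundary a w = (\<Sum>P\<in>?A. cell_boundary a P (Poly_Mapping.lookup w P))" if "w \<in> {u, v, u + v}" for w
    using that by (intro boundary_eq_sum_superset) auto
  then show ?thesis by (simp add: lookup_add cell_boundary_add sum.distrib)
qed

lemma module_hom_boundary:
  "module_hom scale scale (boundary a :: ('n::{finite,linorder} polyhedron \<Rightarrow>\<^sub>0 ('n, 'k::field) mpolynomial) \<Rightarrow> _)"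
proof (intro module_hom.intro module_scale module_hom_axioms.intro)
  fix u v :: "'n polyhedron \<Rightarrow>\<^sub>0 ('n, 'k) mpolynomial" and r
  show "boundary a (u + v) = boundary a u + boundary a v" by (rule boundary_add)
  have "Poly_Mapping.keys (scale r u) \<subseteq> Poly_Mapping.keys u" by (auto simp: in_keys_iff lookup_scale)
  then have "boundary a (scale r u) = (\<Sum>P\<in>Poly_Mapping.keys u. scale r (cell_boundary a P (Poly_Mapping.lookup u P)))"
    by (simp add: boundary_eq_sum_superset[of "Poly_Mapping.keys u"] lookup_scale cell_boundary_mult)
  also have "\<dots> = scale r (boundary a u)"
    by (simp add: boundary_eq_sum_superset[OF finite_keys order_refl] module.scale_sum_right[OF module_scale])
  finally show "boundary a (scale r u) = scale r (boundary a u)" .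
qed

lemmas boundary_0 [simp] = module_hom.zero[OF module_hom_boundary]
  and boundary_diff = module_hom.diff[OF module_hom_boundary]
  and boundary_sum = module_hom.sum[OF module_hom_boundary]

lemma boundary_single: "boundary a (Poly_Mapping.single P p) = cell_boundary a P p"
  by (subst boundary_eq_sum_superset[of "{P}"]) auto

lemma lookup_boundary:
  "Poly_Mapping.lookup (boundary a u) Q
    = (\<Sum>P\<in>Poly_Mapping.keys u. Poly_Mapping.lookup (cell_boundary a P (Poly_Mapping.lookup u P)) Q)"
  by (simp add: boundary_eq_sum_superset[OF finite_keys order_refl] lookup_sum)

text \<open>The incidence sign in an arbitrary ring, since it occurs both as a polynomial and as an
  element of the field.\<close>

definition position_sign :: "'n::linorder \<Rightarrow> 'n set \<Rightarrow> 'r::ring_1"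
  where "position_sign i \<sigma> = (-1) ^ card {j\<in>\<sigma>. j < i}"

text \<open>Deleting the smaller of two indices moves the larger one down by one position; deleting
  the larger leaves the smaller in place.\<close>

lemma position_sign_swap:
  assumes "finite \<sigma>" "i \<in> \<sigma>" "j \<in> \<sigma>" "i \<noteq> j"
  shows "position_sign i \<sigma> * position_sign j (\<sigma> - {i}) = - (position_sign j \<sigma> * position_sign i (\<sigma> - {j}) :: 'r::comm_ring_1)"
proof -
  have *: "position_sign i \<sigma> * position_sign j (\<sigma> - {i}) = - (position_sign j \<sigma> * position_sign i (\<sigma> - {j}) :: 'r)"
    if "i \<in> \<sigma>" "j \<in> \<sigma>" "i < j" for i j
  proof -
    have "{k\<in>\<sigma>. k < j} = insert i {k\<in>\<sigma> - {i}. k < j}" using that by auto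
    then have "card {k\<in>\<sigma>. k < j} = Suc (card {k\<in>\<sigma> - {i}. k < j})" using assms(1) by simp
    moreover have "{k\<in>\<sigma> - {j}. k < i} = {k\<in>\<sigma>. k < i}" using that by auto
    ultimately show ?thesis by (simp add: position_sign_def mult.commute)
  qed
  show ?thesis
  proof (cases "i < j")
    case True
    then show ?thesis using * assms by blast
  next
    case False
    then show ?thesis using *[of j i] assms by simp
  qed
qed

text \<open>The half with \<open>j < i\<close> is swapped onto the half with \<open>i < j\<close>.
  Cancelling in pairs matters in characteristic 2, where a sum equal to its own negative need not
  vanish.\<close>

lemma sum_antisymmetric:
  fixes T :: "'i::linorder \<Rightarrow> 'i \<Rightarrow> 'r::ab_group_add"
  assumes "finite A" and anti: "\<And>i j. i \<in> A \<Longrightarrow> j \<in> A \<Longrightarrow> i < j \<Longrightarrow> T i j + T j i = 0"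
  shows "(\<Sum>i\<in>A. \<Sum>j\<in>A - {i}. T i j) = 0"
proof -
  have "(\<Sum>j\<in>A - {i}. T i j) = (\<Sum>j\<in>A. if i < j then T i j else 0) + (\<Sum>j\<in>A. if j < i then T i j else 0)"
    if "i \<in> A" for i
  proof -
    have "(\<Sum>j\<in>A - {i}. T i j) = (\<Sum>j\<in>A. if j = i then 0 else T i j)"
      using assms(1) by (intro sum.mono_neutral_cong_left) auto
    also have "\<dots> = (\<Sum>j\<in>A. (if i < j then T i j else 0) + (if j < i then T i j else 0))"
      by (intro sum.cong) auto
    finally show ?thesis by (simp add: sum.distrib)
  qed
  then have "(\<Sum>i\<in>A. \<Sum>j\<in>A - {i}. T i j)
      = (\<Sum>i\<in>A. \<Sum>j\<in>A. if i < j then T i j else 0) + (\<Sum>i\<in>A. \<Sum>j\<in>A. if j < i then T i j else 0)"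
    by (simp add: sum.distrib)
  also have "(\<Sum>i\<in>A. \<Sum>j\<in>A. if j < i then T i j else 0) = (\<Sum>i\<in>A. \<Sum>j\<in>A. if i < j then T j i else 0)"
    by (rule sum.swap)
  also have "(\<Sum>i\<in>A. \<Sum>j\<in>A. if i < j then T i j else 0) + (\<Sum>i\<in>A. \<Sum>j\<in>A. if i < j then T j i else 0)
      = (\<Sum>i\<in>A. \<Sum>j\<in>A. if i < j then T i j + T j i else 0)"
    unfolding sum.distrib[symmetric] by (intro sum.cong) auto
  also have "\<dots> = 0" using anti by (intro sum.neutral ballI) auto
  finally show ?thesis .
qed

text \<open>The facts about minimal generators on which the homological argument rests. No
  coefficient field is fixed here, so each lemma may choose its own.\<close>

locale borel_generators =
  fixes G :: "'n::{finite,linorder} exponent set" and a :: "'n exponent" and d :: nat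
  assumes le: "f \<in> G \<Longrightarrow> f \<le> a"
    and degree: "f \<in> G \<Longrightarrow> mono_degree f = d"
    and move_mem: "f \<in> G \<Longrightarrow> i \<in> supp1 f \<Longrightarrow> move f {i} \<in> G"
begin

text \<open>Indexed by dimension, hence one below the homological degree that indexes
  \<open>faces\<close>; the empty face does not occur.\<close>

definition cells :: "nat \<Rightarrow> 'n polyhedron set"
  where "cells k = {cell f \<sigma> |f \<sigma>. f \<in> G \<and> \<sigma> \<subseteq> supp1 f \<and> card \<sigma> = k}"

lemma cellsI: "f \<in> G \<Longrightarrow> \<sigma> \<subseteq> supp1 f \<Longrightarrow> card \<sigma> = k \<Longrightarrow> cell f \<sigma> \<in> cells k"
  unfolding cells_def by blast

lemma cellsE:
  assumes "P \<in> cells k"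
  obtains f \<sigma> where "P = cell f \<sigma>" "f \<in> G" "\<sigma> \<subseteq> supp1 f" "card \<sigma> = k"
  using assms unfolding cells_def by blast

lemma upper_facet:
  assumes "f \<in> G" "\<sigma> \<subseteq> supp1 f" "i \<in> \<sigma>"
  shows "move f {i} \<in> G" "\<sigma> - {i} \<subseteq> supp1 (move f {i})"
  using assms move_mem supp1_move[of "{i}" f] by auto

lemma label_lower_facet:
  assumes f: "f \<in> G" and \<sigma>: "\<sigma> \<subseteq> supp1 f" "i \<in> \<sigma>"
  shows "label a (cell f \<sigma>) = label a (cell f (\<sigma> - {i})) + var_exp i"
proof -
  have "\<sigma> - {i} \<subseteq> supp1 f" using \<sigma> by blast
  then show ?thesis
    using \<sigma> by (auto simp: label_cell le[OF f] vec_eq_iff)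
qed

text \<open>Passing to \<open>move f {i}\<close> multiplies the dual monomial by x_i / x_(i-1), and
  dropping \<open>i\<close> from \<open>\<sigma>\<close> divides by x_i; together this divides by
  x_(i-1).\<close>

lemma label_upper_facet:
  assumes f: "f \<in> G" and \<sigma>: "\<sigma> \<subseteq> supp1 f" "i \<in> \<sigma>"
  shows "label a (cell f \<sigma>) = label a (cell (move f {i}) (\<sigma> - {i})) + var_exp (pred_index i)"
  unfolding label_cell[OF \<sigma>(1) le[OF f]] label_cell[OF upper_facet(2)[OF assms] le[OF upper_facet(1)[OF assms]]]
  unfolding vec_eq_iff
proof
  fix k
  have i: "{i} \<subseteq> supp1 f" using \<sigma> by blast
  have "move f {i} $ k + (if k = i then 1 else 0) = f $ k + (if k = pred_index i then 1 else 0)"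
    using arg_cong[OF move_add_var_exp[OF i], of "\<lambda>v. v $ k"] by simp
  moreover have "f $ k \<le> a $ k" "move f {i} $ k \<le> a $ k"
    using le[OF f] le[OF upper_facet(1)[OF assms]] by (auto simp: less_eq_vec_def)
  moreover have "pred_index i < i" using i supp1_D(3) by blast
  ultimately show "(a - f + sum var_exp \<sigma>) $ k
      = (a - move f {i} + sum var_exp (\<sigma> - {i}) + var_exp (pred_index i)) $ k"
    using \<sigma>(2) by (cases "k = i"; cases "k = pred_index i"; cases "k \<in> \<sigma>") simp_all
qed

text \<open>The lower and upper facets are pairwise distinct polytopes, so the sum over the set of
  facets can be reindexed by \<open>\<sigma>\<close>.\<close>

lemma cell_boundary_cell:
  fixes p :: "('n, 'k::field) mpolynomial"
  assumes f: "f \<in> G" and \<sigma>: "\<sigma> \<subseteq> supp1 f" "\<sigma> \<noteq> {}"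
  shows "cell_boundary a (cell f \<sigma>) p = (\<Sum>i\<in>\<sigma>.
      Poly_Mapping.single (cell f (\<sigma> - {i})) (p * position_sign i \<sigma> * xpow (var_exp i))
    - Poly_Mapping.single (cell (move f {i}) (\<sigma> - {i})) (p * position_sign i \<sigma> * xpow (var_exp (pred_index i))))"
proof -
  let ?A = "(\<lambda>i. cell f (\<sigma> - {i})) ` \<sigma>" and ?B = "(\<lambda>i. cell (move f {i}) (\<sigma> - {i})) ` \<sigma>"
  let ?t = "\<lambda>Q. Poly_Mapping.single Q (p * of_int (incidence Q (cell f \<sigma>)) * xpow (label a (cell f \<sigma>) - label a Q))"
  have i: "\<sigma> - {i} \<subseteq> supp1 f" "{i} \<subseteq> supp1 f" "\<sigma> - {i} \<subseteq> supp1 (move f {i})" "move f {i} \<in> G" if "i \<in> \<sigma>" for i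
    using f \<sigma> that upper_facet[OF f \<sigma>(1) that] by auto
  have injA: "inj_on (\<lambda>i. cell f (\<sigma> - {i})) \<sigma>"
  proof (rule inj_onI)
    fix x y assume xy: "x \<in> \<sigma>" "y \<in> \<sigma>" "cell f (\<sigma> - {x}) = cell f (\<sigma> - {y})"
    then have "\<sigma> - {x} = \<sigma> - {y}" using cell_eq_iff[OF i(1)[OF xy(1)] i(1)[OF xy(2)]] by simp
    then show "x = y" using xy by blast
  qed
  have injB: "inj_on (\<lambda>i. cell (move f {i}) (\<sigma> - {i})) \<sigma>"
  proof (rule inj_onI)
    fix x y assume xy: "x \<in> \<sigma>" "y \<in> \<sigma>" "cell (move f {x}) (\<sigma> - {x}) = cell (move f {y}) (\<sigma> - {y})"
    then have "\<sigma> - {x} = \<sigma> - {y}" using cell_eq_iff[OF i(3)[OF xy(1)] i(3)[OF xy(2)]] by simp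
    then show "x = y" using xy by blast
  qed
  have disj: "?A \<inter> ?B = {}"
  proof -
    have "cell f (\<sigma> - {i}) \<noteq> cell (move f {j}) (\<sigma> - {j})" if "i \<in> \<sigma>" "j \<in> \<sigma>" for i j
      using cell_eq_iff[OF i(1)[OF that(1)] i(3)[OF that(2)]] move_eq_iff[of "{}" f "{j}"] i(2)[OF that(2)] by auto
    then show ?thesis by blast
  qed
  have "facets_of (cell f \<sigma>) = ?A \<union> ?B" unfolding facets_of_cell[OF \<sigma>] by blast
  then have "cell_boundary a (cell f \<sigma>) p = sum ?t ?A + sum ?t ?B"
    unfolding cell_boundary_def using disj by (simp add: sum.union_disjoint)
  also have "sum ?t ?A = (\<Sum>i\<in>\<sigma>. ?t (cell f (\<sigma> - {i})))" using injA by (simp add: sum.reindex)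
  also have "\<dots> = (\<Sum>i\<in>\<sigma>. Poly_Mapping.single (cell f (\<sigma> - {i})) (p * position_sign i \<sigma> * xpow (var_exp i)))"
  proof (rule sum.cong[OF refl])
    fix j assume j: "j \<in> \<sigma>"
    have "label a (cell f \<sigma>) - label a (cell f (\<sigma> - {j})) = var_exp j"
      using label_lower_facet[OF f \<sigma>(1) j] by simp
    then show "?t (cell f (\<sigma> - {j})) = Poly_Mapping.single (cell f (\<sigma> - {j})) (p * position_sign j \<sigma> * xpow (var_exp j))"
      by (simp add: incidence_lower[OF \<sigma>(1) j] position_sign_def)
  qed
  also have "sum ?t ?B = (\<Sum>i\<in>\<sigma>. ?t (cell (move f {i}) (\<sigma> - {i})))" using injB by (simp add: sum.reindex)
  also have "\<dots> = (\<Sum>i\<in>\<sigma>. - Poly_Mapping.single (cell (move f {i}) (\<sigma> - {i})) (p * position_sign i \<sigma> * xpow (var_exp (pred_index i))))"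
  proof (rule sum.cong[OF refl])
    fix j assume j: "j \<in> \<sigma>"
    have "label a (cell f \<sigma>) - label a (cell (move f {j}) (\<sigma> - {j})) = var_exp (pred_index j)"
      using label_upper_facet[OF f \<sigma>(1) j] by simp
    then show "?t (cell (move f {j}) (\<sigma> - {j})) = - Poly_Mapping.single (cell (move f {j}) (\<sigma> - {j})) (p * position_sign j \<sigma> * xpow (var_exp (pred_index j)))"
      by (simp add: incidence_upper[OF \<sigma>(1) j] position_sign_def flip: single_uminus)
  qed
  finally show ?thesis by (simp add: sum_subtractf sum_negf)
qed

lemma cell_boundary_vertex:
  assumes f: "f \<in> G"
  shows "cell_boundary a (cell f {}) p = Poly_Mapping.single {} (p * xpow (a - f))"
  by (simp add: cell_boundary_def facets_of_vertex incidence_def label_cell[OF _ le[OF f]])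

lemma cell_boundary_mem:
  assumes "P \<in> cells (Suc k)"
  shows "cell_boundary a P p \<in> free_module (cells k)"
proof -
  obtain f \<sigma> where P: "P = cell f \<sigma>" "f \<in> G" "\<sigma> \<subseteq> supp1 f" "card \<sigma> = Suc k"
    using assms by (rule cellsE)
  then have "\<sigma> \<noteq> {}" by auto
  show ?thesis unfolding P(1) cell_boundary_cell[OF P(2,3) \<open>\<sigma> \<noteq> {}\<close>]
    using P upper_facet[OF P(2,3)]
    by (intro free_module_sum free_module_diff free_module_single cellsI) auto
qed

lemma boundary_mem:
  assumes "u \<in> free_module (cells (Suc k))"
  shows "boundary a u \<in> free_module (cells k)"
  unfolding boundary_eq_sum_superset[OF finite_keys order_refl]
  using assms by (intro free_module_sum cell_boundary_mem) (auto simp: free_module_def)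

section \<open>The boundary map squares to zero\<close>

text \<open>The ends of an edge have only the empty face as facet, so the formula for larger cells
  does not apply to them. Both ends contribute the label of the edge, with opposite signs.\<close>

lemma boundary_boundary_edge:
  assumes "f \<in> G" "i \<in> supp1 f"
  shows "boundary a (cell_boundary a (cell f {i}) p) = 0"
proof -
  have "move f {i} \<in> G" using assms move_mem by blast
  moreover have "var_exp i + (a - f) = var_exp (pred_index i) + (a - move f {i})"
    unfolding vec_eq_iff
  proof
    fix k
    have "move f {i} $ k + (if k = i then 1 else 0) = f $ k + (if k = pred_index i then 1 else 0)"
      using arg_cong[OF move_add_var_exp[of "{i}" f], of "\<lambda>v. v $ k"] assms by simp
    moreover have "f $ k \<le> a $ k" "move f {i} $ k \<le> a $ k"
      using le[OF assms(1)] le[OF \<open>move f {i} \<in> G\<close>] by (auto simp: less_eq_vec_def)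
    ultimately show "(var_exp i + (a - f)) $ k = (var_exp (pred_index i) + (a - move f {i})) $ k"
      by (auto split: if_splits)
  qed
  ultimately show ?thesis
    using assms by (simp add: cell_boundary_cell boundary_diff boundary_single cell_boundary_vertex
        mult.assoc flip: xpow_mult)
qed

text \<open>A face of codimension 2 arises by choosing the lower or upper side in two directions.
  Both orders of the choices give the same face and the same monomial, with signs that are opposite
  by \<open>position_sign_swap\<close>.\<close>

lemma boundary_cell_boundary:
  fixes p :: "('n, 'k::field) mpolynomial"
  assumes f: "f \<in> G" and \<sigma>: "\<sigma> \<subseteq> supp1 f" "2 \<le> card \<sigma>"
  shows "boundary a (cell_boundary a (cell f \<sigma>) p) = 0"
proof -
  define s :: "'n \<Rightarrow> 'n set \<Rightarrow> ('n, 'k) mpolynomial" where "s = position_sign"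
  define X :: "'n \<Rightarrow> ('n, 'k) mpolynomial" where "X i = xpow (var_exp i)" for i
  define Y :: "'n \<Rightarrow> ('n, 'k) mpolynomial" where "Y i = xpow (var_exp (pred_index i))" for i
  \<comment> \<open>The sides at \<open>i\<close> and \<open>j\<close> are lower-lower, lower-upper,
    upper-lower, upper-upper. In \<open>T i j + T j i\<close> the mixed terms cancel
    crosswise.\<close>
  define T where "T i j =
      Poly_Mapping.single (cell f (\<sigma> - {i} - {j})) (p * s i \<sigma> * X i * s j (\<sigma> - {i}) * X j)
    - Poly_Mapping.single (cell (move f {j}) (\<sigma> - {i} - {j})) (p * s i \<sigma> * X i * s j (\<sigma> - {i}) * Y j)
    - (Poly_Mapping.single (cell (move f {i}) (\<sigma> - {i} - {j})) (p * s i \<sigma> * Y i * s j (\<sigma> - {i}) * X j)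
    - Poly_Mapping.single (cell (move f {i, j}) (\<sigma> - {i} - {j})) (p * s i \<sigma> * Y i * s j (\<sigma> - {i}) * Y j))" for i j
  have ne: "\<sigma> \<noteq> {}" using \<sigma>(2) by auto
  have ne': "\<sigma> - {i} \<noteq> {}" if "i \<in> \<sigma>" for i
  proof -
    have "card (\<sigma> - {i}) \<noteq> 0" using \<sigma>(2) that by simp
    then show ?thesis by auto
  qed
  have "boundary a (cell_boundary a (cell f \<sigma>) p) = (\<Sum>i\<in>\<sigma>. \<Sum>j\<in>\<sigma> - {i}. T i j)"
  proof -
    have "boundary a (cell_boundary a (cell f \<sigma>) p) = (\<Sum>i\<in>\<sigma>.
        cell_boundary a (cell f (\<sigma> - {i})) (p * s i \<sigma> * X i)
      - cell_boundary a (cell (move f {i}) (\<sigma> - {i})) (p * s i \<sigma> * Y i))"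
      unfolding cell_boundary_cell[OF f \<sigma>(1) ne] boundary_sum boundary_diff boundary_single s_def X_def Y_def ..
    also have "\<dots> = (\<Sum>i\<in>\<sigma>. \<Sum>j\<in>\<sigma> - {i}. T i j)"
    proof (rule sum.cong[OF refl])
      fix i assume i: "i \<in> \<sigma>"
      have sub: "\<sigma> - {i} \<subseteq> supp1 f" using \<sigma> by blast
      \<comment> \<open>Merging the two moves makes the upper-upper face visibly symmetric in
        \<open>i\<close> and \<open>j\<close>.\<close>
      have mm: "move (move f {i}) {j} = move f {i, j}" if "j \<in> \<sigma> - {i}" for j
        using move_move[of "{i}" "{j}" f] that i \<sigma>(1) by (auto simp: insert_commute)
      have T: "T i j = (Poly_Mapping.single (cell f (\<sigma> - {i} - {j})) (p * s i \<sigma> * X i * s j (\<sigma> - {i}) * X j)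
            - Poly_Mapping.single (cell (move f {j}) (\<sigma> - {i} - {j})) (p * s i \<sigma> * X i * s j (\<sigma> - {i}) * Y j))
          - (Poly_Mapping.single (cell (move f {i}) (\<sigma> - {i} - {j})) (p * s i \<sigma> * Y i * s j (\<sigma> - {i}) * X j)
            - Poly_Mapping.single (cell (move (move f {i}) {j}) (\<sigma> - {i} - {j})) (p * s i \<sigma> * Y i * s j (\<sigma> - {i}) * Y j))"
        if "j \<in> \<sigma> - {i}" for j
        unfolding T_def mm[OF that] ..
      have "(\<Sum>j\<in>\<sigma> - {i}. T i j) = cell_boundary a (cell f (\<sigma> - {i})) (p * s i \<sigma> * X i)
          - cell_boundary a (cell (move f {i}) (\<sigma> - {i})) (p * s i \<sigma> * Y i)"
        unfolding cell_boundary_cell[OF f sub ne'[OF i]] cell_boundary_cell[OF upper_facet[OF f \<sigma>(1) i] ne'[OF i]]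
        by (rule trans[OF sum.cong[OF refl T]], assumption) (simp only: sum_subtractf s_def X_def Y_def)
      then show "cell_boundary a (cell f (\<sigma> - {i})) (p * s i \<sigma> * X i)
          - cell_boundary a (cell (move f {i}) (\<sigma> - {i})) (p * s i \<sigma> * Y i) = (\<Sum>j\<in>\<sigma> - {i}. T i j)" ..
    qed
    finally show ?thesis .
  qed
  also have "\<dots> = 0"
  proof (rule sum_antisymmetric)
    fix i j assume ij: "i \<in> \<sigma>" "j \<in> \<sigma>" "i < j"
    define c where "c = s i \<sigma> * s j (\<sigma> - {i})"
    have c': "s j \<sigma> * s i (\<sigma> - {j}) = - c"
      unfolding c_def s_def by (rule position_sign_swap) (use ij in auto)
    have 1: "p * s i \<sigma> * A * s j (\<sigma> - {i}) * B = c * (p * A * B)" for A B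
      by (simp only: c_def mult.commute mult.left_commute mult.assoc)
    have 2: "p * s j \<sigma> * A * s i (\<sigma> - {j}) * B = - (c * (p * B * A))" for A B
    proof -
      have "p * s j \<sigma> * A * s i (\<sigma> - {j}) * B = (s j \<sigma> * s i (\<sigma> - {j})) * (p * B * A)"
        by (simp only: mult.commute mult.left_commute mult.assoc)
      then show ?thesis by (simp only: c' mult_minus_left)
    qed
    have "\<sigma> - {j} - {i} = \<sigma> - {i} - {j}" "{j, i} = {i, j}" by auto
    then show "T i j + T j i = 0" by (simp only: T_def 1 2 single_uminus) simp
  qed simp
  finally show ?thesis .
qed

lemma boundary_boundary:
  assumes "u \<in> free_module (cells (Suc k))"
  shows "boundary a (boundary a u) = 0"
proof -
  have "boundary a (cell_boundary a P p) = 0" if P: "P \<in> cells (Suc k)" for P p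
  proof -
    obtain f \<sigma> where f: "P = cell f \<sigma>" "f \<in> G" "\<sigma> \<subseteq> supp1 f" "card \<sigma> = Suc k"
      using P by (rule cellsE)
    show ?thesis
    proof (cases "k = 0")
      case True
      then obtain i where "\<sigma> = {i}" using f(4) card_1_singletonE by auto
      then show ?thesis using f boundary_boundary_edge by simp
    next
      case False
      then show ?thesis using f by (simp add: boundary_cell_boundary[OF f(2,3)])
    qed
  qed
  then show ?thesis
    using assms unfolding boundary_eq_sum_superset[OF finite_keys order_refl, of _ u] boundary_sum
    by (intro sum.neutral) (auto simp: free_module_def)
qed

end

section \<open>Exactness\<close>

text \<open>With positions 1, ..., n this is the sum of j times the exponent of x_j. It drops by one
  for each moved index and so runs against the Borel order.\<close>

definition weight :: "'n::{finite,linorder} exponent \<Rightarrow> nat"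
  where "weight f = (\<Sum>k\<in>UNIV. tail_sum k f)"

lemma weight_move:
  assumes "\<sigma> \<subseteq> supp1 f"
  shows "weight (move f \<sigma>) + card \<sigma> = weight f"
proof -
  have "weight f = (\<Sum>k\<in>UNIV. tail_sum k (move f \<sigma>) + (if k \<in> \<sigma> then 1 else 0))"
    unfolding weight_def by (simp add: tail_sum_move[OF assms])
  also have "\<dots> = weight (move f \<sigma>) + (\<Sum>k\<in>UNIV. if k \<in> \<sigma> then 1 else 0)"
    by (simp only: sum.distrib weight_def)
  also have "(\<Sum>k\<in>UNIV. if k \<in> \<sigma> then 1 else 0) = card \<sigma>" by (simp add: sum.If_cases)
  finally show ?thesis ..
qed

text \<open>As all generators lie below \<open>a\<close>, this bounds their weights by
  \<open>weight a\<close>, so that a term of greatest weight can be chosen.\<close>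

lemma weight_mono: "f \<le> g \<Longrightarrow> weight f \<le> weight g"
  unfolding weight_def tail_sum_def less_eq_vec_def by (intro sum_mono) simp

lemma single_mult_position_sign_xpow:
  "Poly_Mapping.single m c * position_sign i \<sigma> * xpow e
    = (Poly_Mapping.single (m + e) (c * position_sign i \<sigma>) :: ('n::{finite,linorder}, 'k::field) mpolynomial)"
proof -
  have "((-1) ^ k :: ('n, 'k) mpolynomial) = Poly_Mapping.single 0 ((-1) ^ k)" for k
    by (induction k) (simp_all add: single_uminus)
  then have "(position_sign i \<sigma> :: ('n, 'k) mpolynomial) = Poly_Mapping.single 0 (position_sign i \<sigma>)"
    by (simp add: position_sign_def)
  then show ?thesis by (simp add: xpow_def mult_single)
qed

lemma lookup_mult_position_sign_xpow:
  "Poly_Mapping.lookup (p * position_sign i \<sigma> * xpow e) n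
    = (if e \<le> n then position_sign i \<sigma> * Poly_Mapping.lookup (p :: ('n::{finite,linorder}, 'k::field) mpolynomial) (n - e) else 0)"
  by (simp add: lookup_mult_xpow position_sign_def lookup_mult_sign)

text \<open>The cells \<open>C(f,\<sigma>)\<close> with coefficient \<open>x\<^sup>m\<close> are matched by adding or removing the least element \<open>t\<close> of
  \<open>\<sigma> \<union> (supp m \<inter> supp\<^sub>1 f)\<close>; such a term is normal if \<open>t\<close> can be removed, or does not exist.\<close>

definition normal :: "'n::{finite,linorder} exponent \<Rightarrow> 'n exponent \<Rightarrow> 'n set \<Rightarrow> bool"
  where "normal m f \<sigma> \<longleftrightarrow> (\<forall>i\<in>supp1 f. 0 < m $ i \<longrightarrow> (\<exists>j\<in>\<sigma>. j \<le> i))"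

context borel_generators
begin

section \<open>Reduction of chains to normal chains\<close>

text \<open>Normality concerns every monomial of every coefficient. It survives sums and differences
  but in general not multiplication by a monomial, so reduction proceeds term by term.\<close>

definition normal_chains :: "nat \<Rightarrow> ('n polyhedron \<Rightarrow>\<^sub>0 ('n, 'k::field) mpolynomial) set"
  where "normal_chains k = {w \<in> free_module (cells k). \<forall>f\<in>G. \<forall>\<sigma>\<subseteq>supp1 f.
    \<forall>m\<in>Poly_Mapping.keys (Poly_Mapping.lookup w (cell f \<sigma>)). normal m f \<sigma>}"

lemma normal_chains_single:
  assumes "f \<in> G" "\<sigma> \<subseteq> supp1 f" "card \<sigma> = k" "normal m f \<sigma>"
  shows "Poly_Mapping.single (cell f \<sigma>) (Poly_Mapping.single m c) \<in> normal_chains k"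
  using assms cellsI[of f \<sigma> k]
  by (auto simp: normal_chains_def lookup_single when_def cell_eq_iff split: if_splits)

lemma normal_chains_0: "0 \<in> normal_chains k"
  by (simp add: normal_chains_def)

lemma normal_chains_add:
  assumes "u \<in> normal_chains k" "v \<in> normal_chains k"
  shows "u + v \<in> normal_chains k"
proof -
  have "normal m f \<sigma>" if "f \<in> G" "\<sigma> \<subseteq> supp1 f" "m \<in> Poly_Mapping.keys (Poly_Mapping.lookup (u + v) (cell f \<sigma>))" for f \<sigma> m
  proof -
    have "m \<in> Poly_Mapping.keys (Poly_Mapping.lookup u (cell f \<sigma>)) \<or> m \<in> Poly_Mapping.keys (Poly_Mapping.lookup v (cell f \<sigma>))"
      using that(3) by (auto simp: lookup_add in_keys_iff)
    then show ?thesis using assms that unfolding normal_chains_def by blast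
  qed
  then show ?thesis using assms by (auto simp: normal_chains_def free_module_add)
qed

lemma normal_chains_diff:
  assumes "u \<in> normal_chains k" "v \<in> normal_chains k"
  shows "u - v \<in> normal_chains k"
proof -
  have "normal m f \<sigma>" if "f \<in> G" "\<sigma> \<subseteq> supp1 f" "m \<in> Poly_Mapping.keys (Poly_Mapping.lookup (u - v) (cell f \<sigma>))" for f \<sigma> m
  proof -
    have "m \<in> Poly_Mapping.keys (Poly_Mapping.lookup u (cell f \<sigma>)) \<or> m \<in> Poly_Mapping.keys (Poly_Mapping.lookup v (cell f \<sigma>))"
      using that(3) by (auto simp: lookup_minus in_keys_iff)
    then show ?thesis using assms that unfolding normal_chains_def by blast
  qed
  then show ?thesis using assms by (auto simp: normal_chains_def free_module_diff)
qed

text \<open>The chains homologous to a normal chain.\<close>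

definition reducible :: "nat \<Rightarrow> ('n polyhedron \<Rightarrow>\<^sub>0 ('n, 'k::field) mpolynomial) set"
  where "reducible k = {boundary a v + w |v w. v \<in> free_module (cells (Suc k)) \<and> w \<in> normal_chains k}"

lemma reducible_add:
  assumes "u \<in> reducible k" "u' \<in> reducible k"
  shows "u + u' \<in> reducible k"
proof -
  obtain v w v' w' where *: "u = boundary a v + w" "v \<in> free_module (cells (Suc k))" "w \<in> normal_chains k"
    "u' = boundary a v' + w'" "v' \<in> free_module (cells (Suc k))" "w' \<in> normal_chains k"
    using assms unfolding reducible_def by blast
  then have "u + u' = boundary a (v + v') + (w + w')" by (simp add: boundary_add)
  moreover have "v + v' \<in> free_module (cells (Suc k))" "w + w' \<in> normal_chains k"
    using * free_module_add normal_chains_add by blast+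
  ultimately show ?thesis unfolding reducible_def by blast
qed

lemma reducible_diff:
  assumes "u \<in> reducible k" "u' \<in> reducible k"
  shows "u - u' \<in> reducible k"
proof -
  obtain v w v' w' where *: "u = boundary a v + w" "v \<in> free_module (cells (Suc k))" "w \<in> normal_chains k"
    "u' = boundary a v' + w'" "v' \<in> free_module (cells (Suc k))" "w' \<in> normal_chains k"
    using assms unfolding reducible_def by blast
  then have "u - u' = boundary a (v - v') + (w - w')" by (simp add: boundary_diff)
  moreover have "v - v' \<in> free_module (cells (Suc k))" "w - w' \<in> normal_chains k"
    using * free_module_diff normal_chains_diff by blast+
  ultimately show ?thesis unfolding reducible_def by blast
qed

lemma reducible_normal: "w \<in> normal_chains k \<Longrightarrow> w \<in> reducible k"
  unfolding reducible_def using free_module_0 boundary_0 by (metis (mono_tags, lifting) add_0 mem_Collect_eq)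

lemma reducible_boundary: "v \<in> free_module (cells (Suc k)) \<Longrightarrow> boundary a v \<in> reducible k"
  unfolding reducible_def using normal_chains_0 by (metis (mono_tags, lifting) add_0_right mem_Collect_eq)

lemma reducible_sum: "(\<And>i. i \<in> A \<Longrightarrow> u i \<in> reducible k) \<Longrightarrow> (\<Sum>i\<in>A. u i) \<in> reducible k"
  by (induction A rule: infinite_finite_induct) (auto intro: reducible_add reducible_normal normal_chains_0)

text \<open>The term is matched with \<open>cell f (insert t \<sigma>)\<close>. Since
  \<open>t\<close> comes first there, its sign is +1 and the boundary can be solved for the given
  term. Of the other facets, the lower ones carry normal terms and the upper ones have smaller
  weight.\<close>

lemma reducible_term:
  fixes c :: "'k::field"
  assumes "f \<in> G" "\<sigma> \<subseteq> supp1 f" "card \<sigma> = k"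
  shows "Poly_Mapping.single (cell f \<sigma>) (Poly_Mapping.single m c) \<in> reducible k"
  using assms
proof (induction "weight f" arbitrary: f \<sigma> m c rule: less_induct)
  case less
  note f = less.prems
  show ?case
  proof (cases "normal m f \<sigma>")
    case True
    then show ?thesis using f by (intro reducible_normal normal_chains_single)
  next
    case False
    then obtain i\<^sub>0 where i0: "i\<^sub>0 \<in> supp1 f" "0 < m $ i\<^sub>0" "\<And>j. j \<in> \<sigma> \<Longrightarrow> \<not> j \<le> i\<^sub>0"
      by (auto simp: normal_def)
    define A where "A = {i\<in>supp1 f. 0 < m $ i}"
    \<comment> \<open>Failure of normality yields some \<open>i\<^sub>0\<close> below all of
      \<open>\<sigma>\<close>; the least candidate is at most \<open>i\<^sub>0\<close>, hence below
      \<open>\<sigma>\<close> as well.\<close>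
    define t where "t = Min A"
    have A: "finite A" "i\<^sub>0 \<in> A" using i0 by (auto simp: A_def)
    then have "t \<in> A" unfolding t_def by (intro Min_in) auto
    then have t: "t \<in> supp1 f" "0 < m $ t" by (auto simp: A_def)
    have t_le: "t \<le> i" if "i \<in> supp1 f" "0 < m $ i" for i
      using that A unfolding t_def by (intro Min_le) (auto simp: A_def)
    have t_less: "t < j" if "j \<in> \<sigma>" for j using t_le[OF i0(1,2)] i0(3)[OF that] by auto
    define \<tau> where "\<tau> = insert t \<sigma>"
    have \<tau>: "\<tau> \<subseteq> supp1 f" "t \<notin> \<sigma>" "\<tau> \<noteq> {}" using f(2) t t_less by (auto simp: \<tau>_def)
    then have card: "card \<tau> = Suc k" using f(3) by (simp add: \<tau>_def)
    define m' where "m' = m - var_exp t"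
    have m': "m' + var_exp t = m" using t(2) by (simp add: m'_def vec_eq_iff Suc_le_eq)
    define X where "X i = Poly_Mapping.single (cell f (\<tau> - {i})) (Poly_Mapping.single (m' + var_exp i) (c * position_sign i \<tau>))" for i
    define Y where "Y i = Poly_Mapping.single (cell (move f {i}) (\<tau> - {i}))
      (Poly_Mapping.single (m' + var_exp (pred_index i)) (c * position_sign i \<tau>))" for i
    define v where "v = Poly_Mapping.single (cell f \<tau>) (Poly_Mapping.single m' c)"
    have v: "v \<in> free_module (cells (Suc k))" unfolding v_def by (intro free_module_single cellsI f(1) \<tau>(1) card)
    have "boundary a v = (\<Sum>i\<in>\<tau>. X i - Y i)"
      unfolding v_def boundary_single cell_boundary_cell[OF f(1) \<tau>(1,3)] single_mult_position_sign_xpow X_def Y_def ..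
    also have "\<dots> = (X t - Y t) + (\<Sum>i\<in>\<sigma>. X i - Y i)" using \<tau>(2) by (simp add: \<tau>_def)
    also have "X t = Poly_Mapping.single (cell f \<sigma>) (Poly_Mapping.single m c)"
    proof -
      have "\<tau> - {t} = \<sigma>" using \<tau>(2) by (auto simp: \<tau>_def)
      moreover have "{j \<in> \<tau>. j < t} = {}" using t_less by (auto simp: \<tau>_def dest: order.asym)
      then have "(position_sign t \<tau> :: 'k) = 1" unfolding position_sign_def by (simp only: card.empty power_0)
      ultimately show ?thesis unfolding X_def by (simp add: m')
    qed
    finally have eq: "Poly_Mapping.single (cell f \<sigma>) (Poly_Mapping.single m c)
        = boundary a v + Y t - (\<Sum>i\<in>\<sigma>. X i - Y i)" by simp
    have Y: "Y i \<in> reducible k" if "i \<in> \<tau>" for i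
      unfolding Y_def
    proof (rule less.hyps)
      show "weight (move f {i}) < weight f" using weight_move[of "{i}" f] that \<tau>(1) by auto
      show "move f {i} \<in> G" "\<tau> - {i} \<subseteq> supp1 (move f {i})" using upper_facet[OF f(1) \<tau>(1) that] .
      show "card (\<tau> - {i}) = k" using card that by simp
    qed
    \<comment> \<open>These facets keep \<open>t\<close>, and no variable of \<open>supp1 f\<close>
      before x_t divides their monomial, since the new factor x_i has \<open>t < i\<close>.\<close>
    have X: "X i \<in> reducible k" if "i \<in> \<sigma>" for i
      unfolding X_def
    proof (intro reducible_normal normal_chains_single)
      show "f \<in> G" by (rule f(1))
      show "\<tau> - {i} \<subseteq> supp1 f" using \<tau> by blast
      show "card (\<tau> - {i}) = k" using card that by (simp add: \<tau>_def)
      have "t \<in> \<tau> - {i}" using t_less[OF that] by (auto simp: \<tau>_def)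
      moreover have "t \<le> j" if "j \<in> supp1 f" "0 < (m' + var_exp i) $ j" for j
        using that t_le[of j] t_less[OF \<open>i \<in> \<sigma>\<close>] by (cases "j = i") (auto simp: m'_def)
      ultimately show "normal (m' + var_exp i) f (\<tau> - {i})" unfolding normal_def by blast
    qed
    show ?thesis
      unfolding eq using X Y by (intro reducible_diff reducible_add reducible_sum reducible_boundary v) (auto simp: \<tau>_def)
  qed
qed

lemma reducible_chain:
  assumes "u \<in> free_module (cells k)"
  shows "u \<in> reducible k"
proof -
  have "u = (\<Sum>P\<in>Poly_Mapping.keys u. \<Sum>m\<in>Poly_Mapping.keys (Poly_Mapping.lookup u P).
      Poly_Mapping.single P (Poly_Mapping.single m (Poly_Mapping.lookup (Poly_Mapping.lookup u P) m)))"
    unfolding single_sum[symmetric] poly_mapping_eq_sum_single[symmetric] ..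
  moreover have "Poly_Mapping.single P (Poly_Mapping.single m c) \<in> reducible k" if P: "P \<in> Poly_Mapping.keys u" for P m c
  proof -
    have "P \<in> cells k" using assms P by (auto simp: free_module_def)
    then show ?thesis by (elim cellsE) (simp add: reducible_term)
  qed
  ultimately show ?thesis by (metis (no_types, lifting) reducible_sum)
qed

section \<open>Injectivity of the boundary on normal chains\<close>

lemma lookup_cell_boundary:
  fixes p :: "('n, 'k::field) mpolynomial"
  assumes g: "g \<in> G" "\<rho> \<subseteq> supp1 g" "\<rho> \<noteq> {}" and \<sigma>: "\<sigma> \<subseteq> supp1 f"
  shows "Poly_Mapping.lookup (Poly_Mapping.lookup (cell_boundary a (cell g \<rho>) p) (cell f \<sigma>)) n = (\<Sum>i\<in>\<rho>.
      (if g = f \<and> \<rho> - {i} = \<sigma> \<and> var_exp i \<le> n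
        then position_sign i \<rho> * Poly_Mapping.lookup p (n - var_exp i) else 0)
    - (if move g {i} = f \<and> \<rho> - {i} = \<sigma> \<and> var_exp (pred_index i) \<le> n
        then position_sign i \<rho> * Poly_Mapping.lookup p (n - var_exp (pred_index i)) else 0))"
  unfolding cell_boundary_cell[OF g] lookup_sum
proof (rule sum.cong[OF refl])
  fix i assume i: "i \<in> \<rho>"
  have sub: "\<rho> - {i} \<subseteq> supp1 g" "\<rho> - {i} \<subseteq> supp1 (move g {i})" using g upper_facet[OF g(1,2) i] by auto
  show "Poly_Mapping.lookup (Poly_Mapping.lookup
      (Poly_Mapping.single (cell g (\<rho> - {i})) (p * position_sign i \<rho> * xpow (var_exp i))
      - Poly_Mapping.single (cell (move g {i}) (\<rho> - {i})) (p * position_sign i \<rho> * xpow (var_exp (pred_index i)))) (cell f \<sigma>)) n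
    = (if g = f \<and> \<rho> - {i} = \<sigma> \<and> var_exp i \<le> n
        then position_sign i \<rho> * Poly_Mapping.lookup p (n - var_exp i) else 0)
    - (if move g {i} = f \<and> \<rho> - {i} = \<sigma> \<and> var_exp (pred_index i) \<le> n
        then position_sign i \<rho> * Poly_Mapping.lookup p (n - var_exp (pred_index i)) else 0)"
    unfolding lookup_minus lookup_single when_def cell_eq_iff[OF sub(1) \<sigma>] cell_eq_iff[OF sub(2) \<sigma>]
    by (simp add: lookup_mult_position_sign_xpow)
qed

text \<open>An upper facet meeting the selected coefficient would need a generator of greater
  weight, and a second lower facet is excluded by playing the normality of the two terms against
  each other. So the coefficient is a nonzero multiple, by a sign, of a coefficient of
  \<open>w\<close>.\<close>

lemma normal_cycle_eq_0:
  fixes w :: "'n polyhedron \<Rightarrow>\<^sub>0 ('n, 'k::field) mpolynomial"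
  assumes w: "w \<in> normal_chains (Suc k)" and cycle: "boundary a w = 0"
  shows "w = 0"
proof (rule ccontr)
  assume "w \<noteq> 0"
  define S where "S = (\<lambda>(m, f, \<sigma>). f \<in> G \<and> \<sigma> \<subseteq> supp1 f \<and> card \<sigma> = Suc k \<and>
    Poly_Mapping.lookup (Poly_Mapping.lookup w (cell f \<sigma>)) m \<noteq> 0)"
  have cells: "Poly_Mapping.keys w \<subseteq> cells (Suc k)" using w by (auto simp: normal_chains_def free_module_def)
  obtain P where P: "Poly_Mapping.lookup w P \<noteq> 0" using \<open>w \<noteq> 0\<close> by (metis lookup_zero poly_mapping_eqI)
  then obtain m\<^sub>0 where m0: "Poly_Mapping.lookup (Poly_Mapping.lookup w P) m\<^sub>0 \<noteq> 0"
    by (metis lookup_zero poly_mapping_eqI)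
  have "P \<in> cells (Suc k)" using P cells by (auto simp: in_keys_iff)
  then obtain f\<^sub>0 \<sigma>\<^sub>0 where P0: "P = cell f\<^sub>0 \<sigma>\<^sub>0" "f\<^sub>0 \<in> G" "\<sigma>\<^sub>0 \<subseteq> supp1 f\<^sub>0" "card \<sigma>\<^sub>0 = Suc k"
    by (rule cellsE)
  have "S (m\<^sub>0, f\<^sub>0, \<sigma>\<^sub>0)" using P0(2-4) m0 unfolding P0(1) S_def prod.case by blast
  moreover have "weight (fst (snd y)) < Suc (weight a)" if "S y" for y
  proof -
    obtain m f \<sigma> where y: "y = (m, f, \<sigma>)" by (rule prod_cases3)
    then have "f \<in> G" using that unfolding S_def by simp
    then show ?thesis unfolding y by (simp add: less_Suc_eq_le weight_mono le)
  qed
  ultimately have "\<exists>y. S y \<and> (\<forall>z. S z \<longrightarrow> weight (fst (snd z)) \<le> weight (fst (snd y)))"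
    by (intro ex_has_greatest_nat) blast+
  then obtain m f \<sigma> where S: "S (m, f, \<sigma>)" and "\<forall>z. S z \<longrightarrow> weight (fst (snd z)) \<le> weight f"
    by (metis fst_conv snd_conv prod_cases3)
  then have max: "weight g \<le> weight f" if "S (m', g, \<rho>)" for m' g \<rho> using that by fastforce
  have f: "f \<in> G" "\<sigma> \<subseteq> supp1 f" "card \<sigma> = Suc k"
    and m: "Poly_Mapping.lookup (Poly_Mapping.lookup w (cell f \<sigma>)) m \<noteq> 0"
    using S unfolding S_def prod.case by blast+
  have normal: "normal m' g \<rho>" if "S (m', g, \<rho>)" for m' g \<rho>
  proof -
    have "g \<in> G" "\<rho> \<subseteq> supp1 g" "m' \<in> Poly_Mapping.keys (Poly_Mapping.lookup w (cell g \<rho>))"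
      using that unfolding S_def prod.case in_keys_iff by blast+
    then show ?thesis using w unfolding normal_chains_def by blast
  qed
  have "\<sigma> \<noteq> {}" using f(3) by auto
  define t where "t = Min \<sigma>"
  have t: "t \<in> \<sigma>" "\<And>j. j \<in> \<sigma> \<Longrightarrow> t \<le> j" using \<open>\<sigma> \<noteq> {}\<close> by (auto simp: t_def)
  define n where "n = m + var_exp t"
  define c where "c P = Poly_Mapping.lookup (Poly_Mapping.lookup (cell_boundary a P (Poly_Mapping.lookup w P)) (cell f (\<sigma> - {t}))) n" for P
  have sub: "\<sigma> - {t} \<subseteq> supp1 f" using f by blast
  have "c (cell f \<sigma>) = (\<Sum>i\<in>\<sigma>. if i = t then position_sign t \<sigma> * Poly_Mapping.lookup (Poly_Mapping.lookup w (cell f \<sigma>)) m else 0)"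
    unfolding c_def lookup_cell_boundary[OF f(1,2) \<open>\<sigma> \<noteq> {}\<close> sub]
  proof (rule sum.cong[OF refl])
    fix i assume i: "i \<in> \<sigma>"
    have "move f {i} \<noteq> f" using move_eq_iff[of "{i}" f "{}"] f(2) i by auto
    moreover have "\<sigma> - {i} = \<sigma> - {t} \<longleftrightarrow> i = t" using i t by blast
    moreover have "var_exp t \<le> n" "n - var_exp t = m" by (simp_all add: n_def less_eq_vec_def)
    ultimately show "(if f = f \<and> \<sigma> - {i} = \<sigma> - {t} \<and> var_exp i \<le> n
        then position_sign i \<sigma> * Poly_Mapping.lookup (Poly_Mapping.lookup w (cell f \<sigma>)) (n - var_exp i) else 0)
      - (if move f {i} = f \<and> \<sigma> - {i} = \<sigma> - {t} \<and> var_exp (pred_index i) \<le> n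
        then position_sign i \<sigma> * Poly_Mapping.lookup (Poly_Mapping.lookup w (cell f \<sigma>)) (n - var_exp (pred_index i)) else 0)
      = (if i = t then position_sign t \<sigma> * Poly_Mapping.lookup (Poly_Mapping.lookup w (cell f \<sigma>)) m else 0)" by auto
  qed
  also have "\<dots> = position_sign t \<sigma> * Poly_Mapping.lookup (Poly_Mapping.lookup w (cell f \<sigma>)) m"
    using t(1) by simp
  finally have "c (cell f \<sigma>) \<noteq> 0" using m by (simp add: position_sign_def)
  moreover have "c P = 0" if P: "P \<in> Poly_Mapping.keys w - {cell f \<sigma>}" for P
  proof -
    obtain g \<rho> where g: "P = cell g \<rho>" "g \<in> G" "\<rho> \<subseteq> supp1 g" "card \<rho> = Suc k"
      using P cells by (blast elim: cellsE)
    then have "\<rho> \<noteq> {}" by auto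
    \<comment> \<open>For a competing term, \<open>\<rho>\<close> is \<open>\<sigma>\<close> with
      \<open>t\<close> exchanged for \<open>i\<close>. Its normality at \<open>t\<close> forces
      \<open>i < t\<close>; then x_i divides the monomial of the chosen term, whose normality at
      \<open>i\<close> asks for an element of \<open>\<sigma>\<close> below
      \<open>t\<close>.\<close>
    have lower: "Poly_Mapping.lookup (Poly_Mapping.lookup w P) (n - var_exp i) = 0"
      if i: "i \<in> \<rho>" "g = f" "\<rho> - {i} = \<sigma> - {t}" "var_exp i \<le> n" for i
    proof (rule ccontr)
      assume "\<not> ?thesis"
      then have "S (n - var_exp i, g, \<rho>)" using g by (simp add: S_def)
      then have "normal (n - var_exp i) f \<rho>" using normal i(2) by blast
      have "\<rho> \<noteq> \<sigma>" using P g(1) i(2) by auto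
      then have "i \<noteq> t" using i(1,3) t(1) by blast
      then have "t \<notin> \<rho>" using i(3) by blast
      have "t \<in> supp1 f" "0 < (n - var_exp i) $ t" using f t \<open>i \<noteq> t\<close> by (auto simp: n_def)
      then obtain j where j: "j \<in> \<rho>" "j \<le> t" using \<open>normal (n - var_exp i) f \<rho>\<close> unfolding normal_def by blast
      then have "j < t" using \<open>t \<notin> \<rho>\<close> by (auto simp: less_le)
      then have "j \<notin> \<sigma>" using t(2)[of j] by auto
      then have "i < t" using j(1) i(3) \<open>j < t\<close> by blast
      have "1 \<le> n $ i" using i(4) unfolding less_eq_vec_def by (metis var_exp_nth)
      then have "0 < m $ i" using \<open>i \<noteq> t\<close> by (simp add: n_def)
      moreover have "i \<in> supp1 f" using i(1,2) g(3) by blast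
      moreover have "normal m f \<sigma>" using normal S by blast
      ultimately obtain j' where "j' \<in> \<sigma>" "j' \<le> i" unfolding normal_def by blast
      then show False using t(2)[of j'] \<open>i < t\<close> by auto
    qed
    \<comment> \<open>Here the weight of \<open>g\<close> exceeds that of \<open>f\<close> by
      one.\<close>
    have upper: "Poly_Mapping.lookup (Poly_Mapping.lookup w P) (n - var_exp (pred_index i)) = 0"
      if i: "i \<in> \<rho>" "move g {i} = f" for i
    proof (rule ccontr)
      assume "\<not> ?thesis"
      then have "S (n - var_exp (pred_index i), g, \<rho>)" using g by (simp add: S_def)
      then have "weight g \<le> weight f" by (rule max)
      then show False using weight_move[of "{i}" g] i g(3) by auto
    qed
    show ?thesis
      unfolding c_def g(1) lookup_cell_boundary[OF g(2,3) \<open>\<rho> \<noteq> {}\<close> sub]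
      by (rule sum.neutral) (use lower upper g(1) in auto)
  qed
  moreover have "cell f \<sigma> \<in> Poly_Mapping.keys w" using m by (auto simp: in_keys_iff)
  ultimately have "(\<Sum>P\<in>Poly_Mapping.keys w. c P) \<noteq> 0"
    by (subst sum.remove[of _ "cell f \<sigma>"]) auto
  moreover have "(\<Sum>P\<in>Poly_Mapping.keys w. c P) = Poly_Mapping.lookup (Poly_Mapping.lookup (boundary a w) (cell f (\<sigma> - {t}))) n"
    unfolding lookup_boundary lookup_sum c_def ..
  ultimately show False using cycle by simp
qed

text \<open>For empty \<open>\<sigma>\<close>, normality says that the coefficient monomial and
  \<open>f\<close> share no variable except possibly the first. The multidegree fixes the integer
  vector \<open>m - f\<close>, and away from the first index a difference with disjoint supports
  determines both parts. The first exponent follows from \<open>degree\<close>.\<close>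

lemma normal_vertices_eq:
  assumes f: "f \<in> G" "normal m f {}" and g: "g \<in> G" "normal m' g {}"
    and eq: "m' + (a - g) = m + (a - f)"
  shows "f = g"
proof -
  define b :: 'n where "b = Min UNIV"
  have b: "b < i" if "i \<noteq> b" for i using that unfolding b_def by (metis Min_le UNIV_I finite less_le)
  have ne: "f $ i = g $ i" if "i \<noteq> b" for i
  proof -
    have "0 < f $ i \<longrightarrow> m $ i = 0" "0 < g $ i \<longrightarrow> m' $ i = 0"
      using f(2) g(2) b[OF that] by (auto simp: normal_def supp1_def)
    moreover have "f $ i \<le> a $ i" "g $ i \<le> a $ i" using le f(1) g(1) by (auto simp: less_eq_vec_def)
    moreover have "m' $ i + (a $ i - g $ i) = m $ i + (a $ i - f $ i)"
      using arg_cong[OF eq, of "\<lambda>v. v $ i"] by simp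
    ultimately show ?thesis by linarith
  qed
  have "mono_degree f = f $ b + (\<Sum>i\<in>UNIV - {b}. f $ i)" "mono_degree g = g $ b + (\<Sum>i\<in>UNIV - {b}. g $ i)"
    unfolding mono_degree_def by (simp_all add: sum.remove)
  moreover have "(\<Sum>i\<in>UNIV - {b}. f $ i) = (\<Sum>i\<in>UNIV - {b}. g $ i)" using ne by (intro sum.cong) auto
  ultimately have "f $ b = g $ b" using degree[OF f(1)] degree[OF g(1)] by simp
  then show ?thesis using ne by (metis vec_eq_iff)
qed

text \<open>All vertices map to the empty face, so terms can cancel only within one multidegree, and
  there only one vertex can carry a normal term.\<close>

lemma normal_vertex_cycle_eq_0:
  fixes w :: "'n polyhedron \<Rightarrow>\<^sub>0 ('n, 'k::field) mpolynomial"
  assumes w: "w \<in> normal_chains 0" and cycle: "boundary a w = 0"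
  shows "w = 0"
proof (rule ccontr)
  assume "w \<noteq> 0"
  then obtain P where P: "Poly_Mapping.lookup w P \<noteq> 0" by (metis lookup_zero poly_mapping_eqI)
  then obtain m where m: "Poly_Mapping.lookup (Poly_Mapping.lookup w P) m \<noteq> 0"
    by (metis lookup_zero poly_mapping_eqI)
  have vertex: "\<exists>f. P = cell f {} \<and> f \<in> G" if "P \<in> Poly_Mapping.keys w" for P
  proof -
    have "P \<in> cells 0" using that w by (auto simp: normal_chains_def free_module_def)
    then show ?thesis by (elim cellsE) auto
  qed
  have normal: "normal m f {}" if "f \<in> G" "Poly_Mapping.lookup (Poly_Mapping.lookup w (cell f {})) m \<noteq> 0" for m f
    using that w unfolding normal_chains_def by (auto simp: in_keys_iff)
  obtain f where f: "P = cell f {}" "f \<in> G" using vertex[of P] P by (auto simp: in_keys_iff)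
  define n where "n = m + (a - f)"
  define c where "c P = Poly_Mapping.lookup (Poly_Mapping.lookup (cell_boundary a P (Poly_Mapping.lookup w P)) {}) n" for P
  have c: "c (cell g {}) = (if a - g \<le> n then Poly_Mapping.lookup (Poly_Mapping.lookup w (cell g {})) (n - (a - g)) else 0)"
    if "g \<in> G" for g
    unfolding c_def cell_boundary_vertex[OF that] by (simp add: lookup_mult_xpow)
  have "a - f \<le> n" "n - (a - f) = m" by (simp_all add: n_def less_eq_vec_def)
  then have "c P \<noteq> 0" using m f c by simp
  moreover have "c Q = 0" if Q: "Q \<in> Poly_Mapping.keys w - {P}" for Q
  proof -
    obtain g where g: "Q = cell g {}" "g \<in> G" using vertex[of Q] Q by blast
    have "f \<noteq> g" using Q g(1) f(1) by auto
    have "Poly_Mapping.lookup (Poly_Mapping.lookup w (cell g {})) (n - (a - g)) = 0" if le: "a - g \<le> n"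
    proof (rule ccontr)
      assume "\<not> ?thesis"
      then have "normal (n - (a - g)) g {}" using normal g(2) by blast
      moreover have "normal m f {}" using normal f m by blast
      moreover have "n - (a - g) + (a - g) = m + (a - f)"
        using le unfolding n_def[symmetric] by (simp add: vec_eq_iff less_eq_vec_def)
      ultimately show False using normal_vertices_eq f(2) g(2) \<open>f \<noteq> g\<close> by blast
    qed
    then show ?thesis using g c by simp
  qed
  moreover have "P \<in> Poly_Mapping.keys w" using P by (simp add: in_keys_iff)
  ultimately have "(\<Sum>P\<in>Poly_Mapping.keys w. c P) \<noteq> 0" by (subst sum.remove[of _ P]) auto
  moreover have "(\<Sum>P\<in>Poly_Mapping.keys w. c P) = Poly_Mapping.lookup (Poly_Mapping.lookup (boundary a w) {}) n"
    unfolding lookup_boundary lookup_sum c_def ..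
  ultimately show False using cycle by simp
qed

lemma exact_cells:
  "{u \<in> free_module (cells k). boundary a u = 0}
    = boundary a ` (free_module (cells (Suc k)) :: ('n polyhedron \<Rightarrow>\<^sub>0 ('n, 'k::field) mpolynomial) set)"
proof
  show "boundary a ` (free_module (cells (Suc k)) :: ('n polyhedron \<Rightarrow>\<^sub>0 ('n, 'k) mpolynomial) set)
      \<subseteq> {u \<in> free_module (cells k). boundary a u = 0}"
    using boundary_mem boundary_boundary by blast
  show "{u \<in> free_module (cells k). boundary a u = 0}
      \<subseteq> boundary a ` (free_module (cells (Suc k)) :: ('n polyhedron \<Rightarrow>\<^sub>0 ('n, 'k) mpolynomial) set)"
  proof
    fix u :: "'n polyhedron \<Rightarrow>\<^sub>0 ('n, 'k) mpolynomial"
    assume u: "u \<in> {u \<in> free_module (cells k). boundary a u = 0}"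
    then obtain v w where vw: "u = boundary a v + w" "v \<in> free_module (cells (Suc k))" "w \<in> normal_chains k"
      using reducible_chain[of u k] unfolding reducible_def by blast
    have "boundary a w = 0" using u vw boundary_boundary[OF vw(2)] by (simp add: boundary_add)
    \<comment> \<open>For \<open>k = 0\<close> the boundary goes to the empty face, and injectivity
      has its separate reason.\<close>
    then have "w = 0"
      using vw(3) normal_vertex_cycle_eq_0 normal_cycle_eq_0 by (cases k) blast+
    then show "u \<in> boundary a ` free_module (cells (Suc k))" using vw by simp
  qed
qed

end

section \<open>The resolution\<close>

lemma finite_facets_cell: "\<sigma> \<subseteq> supp1 f \<Longrightarrow> finite (facets_of (cell f \<sigma>))"
  by (cases "\<sigma> = {}") (simp_all add: facets_of_vertex facets_of_cell)

context borel_generators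
begin

section \<open>Grading, minimality and the image of the vertices\<close>

text \<open>Serves two purposes: labels of facets divide labels of cells, which makes the boundary
  graded, and the quotient is a variable or, for a vertex, x^(a-f), which is what minimality
  needs.\<close>

lemma label_facet:
  assumes "P \<in> cells k" "Q \<in> facets_of P"
  shows "(\<exists>i. label a P = label a Q + var_exp i) \<or> (\<exists>f\<in>G. k = 0 \<and> label a P = label a Q + (a - f))"
proof -
  obtain f \<sigma> where P: "P = cell f \<sigma>" "f \<in> G" "\<sigma> \<subseteq> supp1 f" "card \<sigma> = k"
    using assms(1) by (rule cellsE)
  show ?thesis
  proof (cases "\<sigma> = {}")
    case True
    then have "label a P = label a Q + (a - f)" "k = 0"
      using assms(2) P by (simp_all add: facets_of_vertex label_cell le)
    then show ?thesis using P(2) by blast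
  next
    case False
    then obtain i where i: "i \<in> \<sigma>" "Q = cell f (\<sigma> - {i}) \<or> Q = cell (move f {i}) (\<sigma> - {i})"
      using assms(2) P(3) facets_of_cell[of \<sigma> f] unfolding P(1) by blast
    from i(2) have "label a P = label a Q + var_exp i \<or> label a P = label a Q + var_exp (pred_index i)"
      unfolding P(1)
    proof
      assume Q: "Q = cell f (\<sigma> - {i})"
      show "label a (cell f \<sigma>) = label a Q + var_exp i \<or> label a (cell f \<sigma>) = label a Q + var_exp (pred_index i)"
        unfolding Q by (rule disjI1) (rule label_lower_facet[OF P(2,3) i(1)])
    next
      assume Q: "Q = cell (move f {i}) (\<sigma> - {i})"
      show "label a (cell f \<sigma>) = label a Q + var_exp i \<or> label a (cell f \<sigma>) = label a Q + var_exp (pred_index i)"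
        unfolding Q by (rule disjI2) (rule label_upper_facet[OF P(2,3) i(1)])
    qed
    then show ?thesis by blast
  qed
qed

lemma lookup_cell_boundary_facet:
  assumes "P \<in> cells k"
  shows "Poly_Mapping.lookup (cell_boundary a P p) Q = (if Q \<in> facets_of P
    then p * of_int (incidence Q P) * xpow (label a P - label a Q) else 0)"
proof -
  have "finite (facets_of P)" using assms by (rule cellsE) (simp add: finite_facets_cell)
  then show ?thesis by (simp add: cell_boundary_def lookup_sum lookup_single when_def sum.delta)
qed

lemma homogeneous_boundary:
  fixes u :: "'n polyhedron \<Rightarrow>\<^sub>0 ('n, 'k::field) mpolynomial"
  assumes u: "u \<in> free_module (cells k)" "homogeneous (label a) \<gamma> u"
  shows "homogeneous (label a) \<gamma> (boundary a u)"
  unfolding homogeneous_def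
proof (intro ballI)
  fix Q m assume "m \<in> Poly_Mapping.keys (Poly_Mapping.lookup (boundary a u) Q)"
  then have "(\<Sum>P\<in>Poly_Mapping.keys u. Poly_Mapping.lookup (Poly_Mapping.lookup (cell_boundary a P (Poly_Mapping.lookup u P)) Q) m) \<noteq> 0"
    by (simp add: in_keys_iff lookup_boundary lookup_sum)
  then obtain P where P: "P \<in> Poly_Mapping.keys u"
    "Poly_Mapping.lookup (Poly_Mapping.lookup (cell_boundary a P (Poly_Mapping.lookup u P)) Q) m \<noteq> 0"
    by (meson sum.neutral)
  then have cell: "P \<in> cells k" using u(1) by (auto simp: free_module_def)
  let ?v = "label a P - label a Q"
  let ?p = "Poly_Mapping.lookup u P * of_int (incidence Q P)"
  have Q: "Q \<in> facets_of P" and "Poly_Mapping.lookup (?p * xpow ?v) m \<noteq> 0"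
    using P(2) unfolding lookup_cell_boundary_facet[OF cell] by (auto split: if_splits)
  then have m: "?v \<le> m" "m - ?v \<in> Poly_Mapping.keys ?p" by (auto simp: lookup_mult_xpow in_keys_iff split: if_splits)
  \<comment> \<open>The incidence number is a constant, so it contributes nothing to the
    exponent.\<close>
  have "Poly_Mapping.keys (of_int (incidence Q P) :: ('n, 'k) mpolynomial) \<subseteq> {0}"
    by (auto simp: in_keys_iff lookup_of_int when_def split: if_splits)
  then have "m - ?v \<in> Poly_Mapping.keys (Poly_Mapping.lookup u P)"
    using subsetD[OF Poly_Mapping.keys_mult m(2)] by auto
  then have "(m - ?v) + label a P = \<gamma>" using u(2) P(1) unfolding homogeneous_def by blast
  moreover have "label a P = label a Q + ?v" using label_facet[OF cell Q] by (auto simp: vec_eq_iff)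
  moreover have "m = (m - ?v) + ?v" using m(1) by (simp add: vec_eq_iff less_eq_vec_def)
  ultimately show "m + label a Q = \<gamma>" by (metis add.assoc add.commute)
qed

text \<open>Only vertices could produce a unit coefficient: theirs is x^(a-f), which is 1 exactly
  for \<open>f = a\<close>.\<close>

lemma boundary_coefficient_mem_max_ideal:
  fixes u :: "'n polyhedron \<Rightarrow>\<^sub>0 ('n, 'k::field) mpolynomial"
  assumes "a \<notin> G" and u: "u \<in> free_module (cells k)"
  shows "Poly_Mapping.lookup (boundary a u) Q \<in> max_ideal"
proof -
  have "Poly_Mapping.lookup (cell_boundary a P (Poly_Mapping.lookup u P)) Q \<in> max_ideal"
    if "P \<in> Poly_Mapping.keys u" for P
  proof -
    have cell: "P \<in> cells k" using that u by (auto simp: free_module_def)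
    have "\<exists>i. var_exp i \<le> label a P - label a Q" if "Q \<in> facets_of P"
    proof -
      from label_facet[OF cell that] consider i where "label a P = label a Q + var_exp i"
        | f where "f \<in> G" "label a P = label a Q + (a - f)" by blast
      then show ?thesis
      proof cases
        case 2
        then have "f \<noteq> a" "f \<le> a" using assms(1) le by auto
        then obtain i where "f $ i < a $ i" by (metis less_eq_vec_def nat_less_le vec_eq_iff)
        then have "var_exp i \<le> label a P - label a Q" by (simp add: 2(2) less_eq_vec_def)
        then show ?thesis ..
      qed auto
    qed
    then have "xpow (label a P - label a Q) \<in> (max_ideal :: ('n, 'k) mpolynomial set)" if "Q \<in> facets_of P"
      using that unfolding max_ideal_def xpow_mem_mono_ideal_iff by blast
    then show ?thesis
      unfolding lookup_cell_boundary_facet[OF cell] max_ideal_def mono_ideal_def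
      by (auto intro: module.span_scale[OF module_times] module.span_zero[OF module_times])
  qed
  then show ?thesis
    unfolding lookup_boundary max_ideal_def mono_ideal_def by (intro module.span_sum[OF module_times])
qed

text \<open>The basis element \<open>{}\<close> identifies the last module with the ring. There the
  image of the vertices is an ideal that contains each x^(a-f) and consists of sums of their
  multiples.\<close>

lemma boundary_vertices:
  "boundary a ` (free_module (cells 0) :: ('n polyhedron \<Rightarrow>\<^sub>0 ('n, 'k::field) mpolynomial) set)
    = Poly_Mapping.single {} ` mono_ideal ((\<lambda>f. a - f) ` G)" (is "boundary a ` ?F = Poly_Mapping.single {} ` ?J")
proof
  show "boundary a ` ?F \<subseteq> Poly_Mapping.single {} ` ?J"
  proof
    fix y assume "y \<in> boundary a ` ?F"
    then obtain u :: "'n polyhedron \<Rightarrow>\<^sub>0 ('n, 'k) mpolynomial" where u: "y = boundary a u" "u \<in> ?F" by blast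
    define p where "p P = Poly_Mapping.lookup (cell_boundary a P (Poly_Mapping.lookup u P)) {}" for P
    have "cell_boundary a P (Poly_Mapping.lookup u P) = Poly_Mapping.single {} (p P) \<and> p P \<in> ?J"
      if P: "P \<in> Poly_Mapping.keys u" for P
    proof -
      have "P \<in> cells 0" using P u(2) by (auto simp: free_module_def)
      then obtain f where f: "P = cell f {}" "f \<in> G" by (rule cellsE) auto
      have "xpow (a - f) \<in> ?J" unfolding mono_ideal_def using f(2) by (intro module.span_base[OF module_times]) blast
      then have "Poly_Mapping.lookup u P * xpow (a - f) \<in> ?J"
        unfolding mono_ideal_def by (rule module.span_scale[OF module_times])
      then show ?thesis unfolding p_def f(1) cell_boundary_vertex[OF f(2)] by simp
    qed
    then have "y = Poly_Mapping.single {} (\<Sum>P\<in>Poly_Mapping.keys u. p P)" "(\<Sum>P\<in>Poly_Mapping.keys u. p P) \<in> ?J"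
      unfolding u(1) boundary_eq_sum_superset[OF finite_keys order_refl] single_sum mono_ideal_def
      by (auto intro: module.span_sum[OF module_times] sum.cong)
    then show "y \<in> Poly_Mapping.single {} ` ?J" by blast
  qed
  have "?J \<subseteq> {p. Poly_Mapping.single {} p \<in> boundary a ` ?F}"
    unfolding mono_ideal_def
  proof (rule module.span_minimal[OF module_times])
    show "xpow ` (\<lambda>f. a - f) ` G \<subseteq> {p. Poly_Mapping.single {} p \<in> boundary a ` ?F}"
    proof clarify
      fix f assume f: "f \<in> G"
      have "Poly_Mapping.single {} (xpow (a - f)) = boundary a (Poly_Mapping.single (cell f {}) (1 :: ('n, 'k) mpolynomial))"
        by (simp add: boundary_single cell_boundary_vertex[OF f])
      moreover have "Poly_Mapping.single (cell f {}) (1 :: ('n, 'k) mpolynomial) \<in> ?F"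
        using f by (intro free_module_single cellsI) auto
      ultimately show "Poly_Mapping.single {} (xpow (a - f) :: ('n, 'k) mpolynomial) \<in> boundary a ` ?F" by blast
    qed
    show "module.subspace (*) {p. Poly_Mapping.single {} p \<in> boundary a ` ?F}"
    proof (rule module.subspaceI[OF module_times])
      show "0 \<in> {p. Poly_Mapping.single {} p \<in> boundary a ` ?F}"
        by (auto intro: image_eqI[of _ _ 0])
      fix p q c assume p: "p \<in> {p. Poly_Mapping.single {} p \<in> boundary a ` ?F}"
      then obtain u where u: "Poly_Mapping.single {} p = boundary a u" "u \<in> ?F" by blast
      have "Poly_Mapping.single {} (c * p) = scale c (Poly_Mapping.single {} p)"
        by (rule poly_mapping_eqI) (simp add: lookup_scale lookup_single when_def)
      also have "\<dots> = boundary a (scale c u)" unfolding u(1) by (rule module_hom.scale[OF module_hom_boundary, symmetric])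
      finally have "Poly_Mapping.single {} (c * p) = boundary a (scale c u)" .
      moreover have "Poly_Mapping.keys (scale c u) \<subseteq> Poly_Mapping.keys u"
        by (auto simp: in_keys_iff lookup_scale)
      then have "scale c u \<in> ?F" using u(2) by (auto simp: free_module_def)
      ultimately show "c * p \<in> {p. Poly_Mapping.single {} p \<in> boundary a ` ?F}" by blast
      assume "q \<in> {p. Poly_Mapping.single {} p \<in> boundary a ` ?F}"
      then obtain v where v: "Poly_Mapping.single {} q = boundary a v" "v \<in> ?F" by blast
      have "Poly_Mapping.single {} (p + q) = boundary a (u + v)" by (simp add: single_add u(1) v(1) boundary_add)
      then show "p + q \<in> {p. Poly_Mapping.single {} p \<in> boundary a ` ?F}"
        using free_module_add[OF u(2) v(2)] by blast
    qed
  qed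
  then show "Poly_Mapping.single {} ` ?J \<subseteq> boundary a ` ?F" by blast
qed

end

section \<open>Generators of a strongly stable ideal in one degree\<close>

text \<open>A monomial of degree \<open>d\<close> in the ideal is a multiple of a generator of the
  same degree, so the two agree. Being a minimal generator thus reduces to membership in the ideal,
  to which strong stability applies.\<close>

lemma min_gens_iff_degree:
  fixes I :: "('n::finite, 'k::field) mpolynomial set"
  assumes "monomial_ideal I" "generated_in_degree d I"
  shows "f \<in> min_gens I \<longleftrightarrow> mono_degree f = d \<and> xpow f \<in> I"
proof -
  obtain S where S: "I = mono_ideal S" using assms(1) by (auto simp: monomial_ideal_def)
  note gens = min_gens_mono_ideal[of S, where 'k='k, folded S]
  have deg: "mono_degree f = d" if "f \<in> min_gens I" for f
    using that assms(2) by (simp add: generated_in_degree_def)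
  show ?thesis
  proof
    assume f: "f \<in> min_gens I"
    then have "f \<in> S" unfolding gens by blast
    then have "xpow f \<in> I" unfolding S xpow_mem_mono_ideal_iff by blast
    then show "mono_degree f = d \<and> xpow f \<in> I" using deg f by blast
  next
    assume f: "mono_degree f = d \<and> xpow f \<in> I"
    then obtain s where s: "s \<in> S" "s \<le> f" unfolding S xpow_mem_mono_ideal_iff by blast
    then obtain t where t: "t \<in> min_gens I" "t \<le> s" using minimal_below[of s S] unfolding gens by blast
    have "t \<le> f" using t s by order
    then have le: "t $ i \<le> f $ i" for i by (simp add: less_eq_vec_def)
    have "(\<Sum>i\<in>UNIV. t $ i) = (\<Sum>i\<in>UNIV. f $ i)" using deg[OF t(1)] f by (simp add: mono_degree_def)
    then have "t $ i = f $ i" for i by (rule sum_mono_inv) (simp_all add: le)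
    then have "t = f" by (simp add: vec_eq_iff)
    then show "f \<in> min_gens I" using t by simp
  qed
qed

lemma borel_generators_min_gens:
  fixes I :: "('n::{finite,linorder}, 'k::field) mpolynomial set"
  assumes "strongly_stable I" "determined a I" "generated_in_degree d I"
  shows "borel_generators (min_gens I) a d"
proof
  have mono: "monomial_ideal I" using assms(1) by (simp add: strongly_stable_def)
  fix f assume f: "f \<in> min_gens I"
  then have f': "mono_degree f = d" "xpow f \<in> I" using min_gens_iff_degree[OF mono assms(3)] by blast+
  show "f \<le> a" using f assms(2) by (simp add: determined_def)
  show "mono_degree f = d" by (rule f'(1))
  fix i assume i: "i \<in> supp1 f"
  have eq: "move f {i} + var_exp i = f + var_exp (pred_index i)" using move_add_var_exp[of "{i}" f] i by simp
  \<comment> \<open>\<open>strongly_stable\<close> divides before it multiplies, \<open>move\<close>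
    the other way round; as x_i divides \<open>f\<close>, the truncated subtractions agree.\<close>
  have "move f {i} = f - var_exp i + var_exp (pred_index i)"
    unfolding vec_eq_iff
  proof
    fix k
    show "move f {i} $ k = (f - var_exp i + var_exp (pred_index i)) $ k"
      using arg_cong[OF eq, of "\<lambda>v. v $ k"] supp1_D(1)[OF i] by (cases "k = i") auto
  qed
  then have "xpow (move f {i}) \<in> I"
    using assms(1) f'(2) supp1_D(1,3)[OF i] unfolding strongly_stable_def by metis
  moreover have "mono_degree (move f {i}) + mono_degree (var_exp i) = mono_degree f + mono_degree (var_exp (pred_index i))"
    using arg_cong[OF eq, of mono_degree] by (simp add: mono_degree_def sum.distrib)
  then have "mono_degree (move f {i}) = mono_degree f" by (simp add: mono_degree_def)
  ultimately show "move f {i} \<in> min_gens I" using f' min_gens_iff_degree[OF mono assms(3)] by simp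
qed

section \<open>Faces by homological degree and the assembled resolution\<close>

lemma faces_0: "faces (I :: ('n::{finite,linorder}, 'k::field) mpolynomial set) 0 = {{}}"
  unfolding faces_def cell_complex_def by (auto simp: aff_dim_cell)

lemma faces_Suc:
  fixes I :: "('n::{finite,linorder}, 'k::field) mpolynomial set"
  assumes "borel_generators (min_gens I) a d"
  shows "faces I (Suc k) = borel_generators.cells (min_gens I) k"
proof -
  interpret borel_generators "min_gens I" a d by (rule assms)
  show ?thesis
  proof
    show "faces I (Suc k) \<subseteq> cells k"
      unfolding faces_def cell_complex_def by (auto simp: aff_dim_cell intro: cellsI)
    show "cells k \<subseteq> faces I (Suc k)"
      unfolding faces_def cell_complex_def cells_def by (auto simp: aff_dim_cell)
  qed
qed

lemma graded_free_resolution_boundary: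
  fixes I :: "('n::{finite,linorder}, 'k::field) mpolynomial set"
  assumes "borel_generators (min_gens I) a d"
  shows "graded_free_resolution (faces I) (label a) (boundary a) (dual_ideal a I)"
proof -
  interpret borel_generators "min_gens I" a d by (rule assms)
  note faces_Suc = faces_Suc[OF assms]
  show ?thesis
    unfolding graded_free_resolution_def
  proof (intro conjI allI ballI impI exI[of _ "{}"])
    show "module_hom scale scale (boundary a :: _ \<Rightarrow> ('n polyhedron \<Rightarrow>\<^sub>0 ('n, 'k) mpolynomial))"
      by (rule module_hom_boundary)
    show "{u \<in> free_module (faces I (Suc k)). boundary a u = 0}
        = boundary a ` (free_module (faces I (Suc (Suc k))) :: ('n polyhedron \<Rightarrow>\<^sub>0 ('n, 'k) mpolynomial) set)" for k
      unfolding faces_Suc by (rule exact_cells)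
    show "faces I 0 = {{}}" "label a {} = 0" by (simp_all add: faces_0)
    show "boundary a ` free_module (faces I (Suc 0)) = Poly_Mapping.single {} ` dual_ideal a I"
      unfolding faces_Suc dual_ideal_def by (rule boundary_vertices)
    fix k \<gamma> and u :: "'n polyhedron \<Rightarrow>\<^sub>0 ('n, 'k) mpolynomial"
    assume u: "u \<in> free_module (faces I (Suc k))"
    show "boundary a u \<in> free_module (faces I k)"
    proof (cases k)
      \<comment> \<open>The empty face is not among the \<open>cells\<close>, so this degree is read
        off from the image of the vertices.\<close>
      case 0
      then have "boundary a u \<in> boundary a ` free_module (cells 0)" using u unfolding faces_Suc by blast
      then obtain p where "boundary a u = Poly_Mapping.single {} p" unfolding boundary_vertices by blast
      then show ?thesis by (simp add: 0 faces_0)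
    next
      case (Suc l)
      then show ?thesis using u boundary_mem[of u l] by (simp add: faces_Suc)
    qed
    assume "homogeneous (label a) \<gamma> u"
    with u show "homogeneous (label a) \<gamma> (boundary a u)"
      unfolding faces_Suc by (rule homogeneous_boundary)
  qed
qed

text \<open>The coefficient field \<open>'l\<close> of the complex is a type variable of its own, because nothing in
  \<open>minimal_complex (faces I) (boundary a)\<close> ties it to the field of \<open>I\<close>.\<close>

lemma minimal_complex_boundary:
  fixes I :: "('n::{finite,linorder}, 'k::field) mpolynomial set"
  assumes "borel_generators (min_gens I) a d" and "dual_ideal a I \<noteq> UNIV"
  shows "minimal_complex (faces I) (boundary a :: ('n polyhedron \<Rightarrow>\<^sub>0 ('n, 'l::field) mpolynomial) \<Rightarrow> _)"
proof -
  interpret borel_generators "min_gens I" a d by (rule assms)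
  have "a \<notin> min_gens I"
  proof
    assume "a \<in> min_gens I"
    then have "xpow 0 \<in> dual_ideal a I" unfolding dual_ideal_def xpow_mem_mono_ideal_iff by force
    then have "p * xpow 0 \<in> dual_ideal a I" for p
      unfolding dual_ideal_def mono_ideal_def by (rule module.span_scale[OF module_times])
    then show False using assms(2) by (auto simp: xpow_def)
  qed
  then show ?thesis
    unfolding minimal_complex_def faces_Suc[OF assms(1)] by (intro allI ballI boundary_coefficient_mem_max_ideal)
qed

theorem theorem5p3:
  fixes I :: "('n::{finite,linorder}, 'k::field) mpolynomial set"
    and a :: "'n exponent" and d :: nat
  assumes "strongly_stable I"
    and "determined a I"
    and "generated_in_degree d I"
  shows "graded_free_resolution (faces I) (label a) (boundary a) (dual_ideal a I) \<and>
    (dual_ideal a I \<noteq> UNIV \<longrightarrow> minimal_complex (faces I) (boundary a))"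
  using graded_free_resolution_boundary minimal_complex_boundary borel_generators_min_gens[OF assms] by blast

end
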